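(* Let $G=(V,E)$ be a connected graph, $s,t\in V$, and suppose $|\delta(U)|\ge3$ for every $\emptyset\ne U\subsetneq V$ with $|U\cap\{s,t\}|\ne1$. Then the all-ones vector $\mathbf{1}\in\mathbb{R}^E$ can be expressed as a convex combination of (incidence vectors of) $\{s,t\}$-tours of $G$.
   Context: $\delta(U)$ denotes the set of edges of $G$ with exactly one endpoint in $U$. An $\{s,t\}$-tour of $G$ is a multiset of edges of $E$ forming a connected spanning multigraph on $V$ whose set of odd-degree vertices is $\{s\}\triangle\{t\}$ (i.e. $\{s,t\}$ if $s\ne t$, and empty if $s=t$); its incidence vector records multiplicities. *)

theory Defs
  imports Complex_Main "HOL-Library.Multiset"
begin

text \<open>
  Finite undirected graphs without loops, parallel edges allowed: \<open>ends e\<close> is the set of the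
  two endpoints of the edge \<open>e\<close>. A simple graph is the case where \<open>E\<close> consists of two-element
  subsets of \<open>V\<close> and \<open>ends\<close> is the identity.
\<close>

locale multigraph =
  fixes V :: "'v set" and E :: "'e set" and ends :: "'e \<Rightarrow> 'v set"
  assumes finite_V: "finite V"
    and finite_E: "finite E"
    and ends_subset: "\<And>e. e \<in> E \<Longrightarrow> ends e \<subseteq> V"
    and card_ends: "\<And>e. e \<in> E \<Longrightarrow> card (ends e) = 2"

definition connected_by :: "'v set \<Rightarrow> ('e \<Rightarrow> 'v set) \<Rightarrow> 'e set \<Rightarrow> bool" where
  "connected_by V ends F \<longleftrightarrow>
     (\<forall>u\<in>V. \<forall>v\<in>V. (u, v) \<in> {(x, y). \<exists>e\<in>F. ends e = {x, y}}\<^sup>*)"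

definition edge_cut :: "'e set \<Rightarrow> ('e \<Rightarrow> 'v set) \<Rightarrow> 'v set \<Rightarrow> 'e set" where
  "edge_cut E ends U = {e \<in> E. card (ends e \<inter> U) = 1}"

text \<open>As there are no loops, each copy of an edge contributes at most 1 to a degree.\<close>

definition vertex_degree :: "('e \<Rightarrow> 'v set) \<Rightarrow> 'e multiset \<Rightarrow> 'v \<Rightarrow> nat" where
  "vertex_degree ends M v = size {#e \<in># M. v \<in> ends e#}"

definition st_tour :: "'v set \<Rightarrow> 'e set \<Rightarrow> ('e \<Rightarrow> 'v set) \<Rightarrow> 'v \<Rightarrow> 'v \<Rightarrow> 'e multiset \<Rightarrow> bool" where
  "st_tour V E ends s t M \<longleftrightarrow>
     set_mset M \<subseteq> E \<and> connected_by V ends (set_mset M) \<and>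
     {v \<in> V. odd (vertex_degree ends M v)} = sym_diff {s} {t}"

definition incidence_vector :: "'e multiset \<Rightarrow> 'e \<Rightarrow> real" where
  "incidence_vector M e = real (count M e)"

text \<open>
  Vectors indexed by \<open>E\<close> are functions of which only the values on \<open>E\<close> matter; function types
  are not an instance of \<open>real_vector\<close>, so \<open>convex hull\<close> does not apply.
\<close>

definition convex_combination_of :: "'e set \<Rightarrow> ('e \<Rightarrow> real) \<Rightarrow> ('e \<Rightarrow> real) set \<Rightarrow> bool" where
  "convex_combination_of E x X \<longleftrightarrow>
     (\<exists>S c. finite S \<and> S \<subseteq> X \<and> (\<forall>y\<in>S. 0 \<le> c y) \<and> sum c S = 1 \<and>
        (\<forall>e\<in>E. x e = (\<Sum>y\<in>S. c y * y e)))"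

end

theory Submission
  imports Defs
begin

text \<open>
  Every tour constructed here is an edge set \<open>D\<close> with odd-degree vertices \<open>{s} \<triangle> {t}\<close> together with
  some edges of \<open>M = E - D\<close> taken twice. If every cut avoiding \<open>D\<close> has at least four edges, then \<open>G\<close>
  with the components of \<open>D\<close> contracted is 4-edge-connected, so by matroid union \<open>M\<close> splits into two
  parts \<open>F\<^sub>1\<close>, \<open>F\<^sub>2\<close> each of which makes \<open>D\<close> connected; the average of \<open>D + 2 F\<^sub>1\<close> and \<open>D + 2 F\<^sub>2\<close> is
  the all-ones vector.

  To find \<open>D\<close>, add an edge \<open>f = st\<close> (if \<open>s \<noteq> t\<close>), so that every odd cut has at least three edges,
  and let \<open>T\<close> be the set of odd-degree vertices. By the min-max theorem for T-joins the vector \<open>1/3\<close>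
  bounds a minimum T-join for every weight. Weighting each edge by the number of 3-cuts through it,
  with one unit more on \<open>f\<close>, yields a T-join that meets every 3-cut exactly once and avoids \<open>f\<close>.
  Its complement contains \<open>f\<close>, has even degrees and meets every 3-cut; \<open>D\<close> is that complement
  without \<open>f\<close>.
\<close>

section \<open>Reachability and parity of edge sets\<close>

abbreviation adj :: "('e \<Rightarrow> 'v set) \<Rightarrow> 'e set \<Rightarrow> ('v \<times> 'v) set" where
  "adj ends F \<equiv> {(x, y). \<exists>e\<in>F. ends e = {x, y}}"

definition reach :: "('e \<Rightarrow> 'v set) \<Rightarrow> 'e set \<Rightarrow> 'v \<Rightarrow> 'v set" where
  "reach ends F a = (adj ends F)\<^sup>* `` {a}"

lemma adj_rtrancl_mono: "F \<subseteq> G \<Longrightarrow> (adj ends F)\<^sup>* \<subseteq> (adj ends G)\<^sup>*"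
  by (rule rtrancl_mono) auto

lemma sym_adj_rtrancl: "sym ((adj ends F)\<^sup>*)"
  by (rule sym_rtrancl) (auto simp: sym_def insert_commute)

lemma adj_rtrancl_sym: "(x, y) \<in> (adj ends F)\<^sup>* \<Longrightarrow> (y, x) \<in> (adj ends F)\<^sup>*"
  using sym_adj_rtrancl by (rule symD)

lemma reach_refl [simp]: "a \<in> reach ends F a"
  by (simp add: reach_def)

lemma reach_iff: "v \<in> reach ends F a \<longleftrightarrow> (a, v) \<in> (adj ends F)\<^sup>*"
  by (simp add: reach_def)

lemma reach_step: "v \<in> reach ends F a \<Longrightarrow> e \<in> F \<Longrightarrow> ends e = {v, u} \<Longrightarrow> u \<in> reach ends F a"
  unfolding reach_iff by (erule rtrancl_into_rtrancl) auto

lemma reach_eq: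
  assumes "u \<in> reach ends F b"
  shows "reach ends F u = reach ends F b"
proof -
  have bu: "(b, u) \<in> (adj ends F)\<^sup>*" using assms by (simp add: reach_iff)
  then have ub: "(u, b) \<in> (adj ends F)\<^sup>*" by (rule adj_rtrancl_sym)
  show ?thesis
    using rtrancl_trans[OF bu] rtrancl_trans[OF ub] by (simp only: set_eq_iff reach_iff) blast
qed

context multigraph
begin

text \<open>The boundary over GF(2): \<open>F\<close> is a T-join for \<open>T = odd_set F\<close>,
  and \<open>odd_set F = {}\<close> puts \<open>F\<close> in the cycle space.\<close>

definition odd_set :: "'e set \<Rightarrow> 'v set" where
  "odd_set F = {v \<in> V. odd (card {e \<in> F. v \<in> ends e})}"

lemma finite_edges: "F \<subseteq> E \<Longrightarrow> finite F"
  using finite_E finite_subset by blast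

lemma odd_set_empty [simp]: "odd_set {} = {}"
  by (simp add: odd_set_def)

lemma odd_set_single: "e \<in> E \<Longrightarrow> odd_set {e} = ends e"
proof -
  assume e: "e \<in> E"
  have "{e' \<in> {e}. v \<in> ends e'} = (if v \<in> ends e then {e} else {})" for v
    by auto
  then show ?thesis using ends_subset[OF e] by (auto simp: odd_set_def)
qed

lemma odd_card_sym_diff:
  assumes "finite A" "finite B"
  shows "odd (card (sym_diff A B)) \<longleftrightarrow> odd (card A) \<noteq> odd (card B)"
proof -
  have "card (sym_diff A B) = card (A - B) + card (B - A)"
    using assms by (intro card_Un_disjoint) auto
  moreover have "card A = card (A - B) + card (A \<inter> B)"
    using assms by (subst card_Un_disjoint[symmetric]) (auto intro!: arg_cong[where f = card])
  moreover have "card B = card (B - A) + card (A \<inter> B)"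
    using assms by (subst card_Un_disjoint[symmetric]) (auto intro!: arg_cong[where f = card])
  ultimately show ?thesis by auto
qed

lemma odd_set_sym_diff:
  assumes "F \<subseteq> E" "G \<subseteq> E"
  shows "odd_set (sym_diff F G) = sym_diff (odd_set F) (odd_set G)"
proof -
  have "odd (card {e \<in> sym_diff F G. v \<in> ends e}) \<longleftrightarrow>
    odd (card {e \<in> F. v \<in> ends e}) \<noteq> odd (card {e \<in> G. v \<in> ends e})" for v
  proof -
    have "{e \<in> sym_diff F G. v \<in> ends e} = sym_diff {e \<in> F. v \<in> ends e} {e \<in> G. v \<in> ends e}"
      by auto
    moreover have "finite {e \<in> F. v \<in> ends e}" "finite {e \<in> G. v \<in> ends e}"
      using assms[THEN finite_edges] by simp_all
    ultimately show ?thesis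
      by (simp only: odd_card_sym_diff)
  qed
  then show ?thesis unfolding odd_set_def by auto
qed

lemma odd_set_toggle:
  assumes "F \<subseteq> E" "e \<in> E" "ends e = {u, v}"
  shows "odd_set (sym_diff F {e}) = sym_diff (odd_set F) {u, v}"
  using odd_set_sym_diff[of F "{e}"] odd_set_single[of e] assms by simp

lemma ends_distinct: "e \<in> E \<Longrightarrow> ends e = {u, v} \<Longrightarrow> u \<noteq> v"
  using card_ends[of e] by auto

lemma edge_cut_iff:
  assumes "e \<in> E" "U \<subseteq> V"
  shows "card (ends e \<inter> U) = 1 \<longleftrightarrow> (\<exists>u v. ends e = {u, v} \<and> u \<in> U \<and> v \<in> V \<and> v \<notin> U)"
proof -
  obtain x y where xy: "ends e = {x, y}" "x \<noteq> y"
    using card_ends[OF assms(1)] by (auto simp: card_2_iff)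
  have "x \<in> V" "y \<in> V" using ends_subset[OF assms(1)] xy by auto
  then show ?thesis using xy by (cases "x \<in> U"; cases "y \<in> U") (auto simp: doubleton_eq_iff)
qed

lemma edge_cutE:
  assumes "e \<in> edge_cut F ends U" "F \<subseteq> E" "U \<subseteq> V"
  obtains u v where "e \<in> F" "ends e = {u, v}" "u \<in> U" "v \<in> V" "v \<notin> U"
  using assms edge_cut_iff[of e U] unfolding edge_cut_def by blast

lemma edge_cutI:
  assumes "e \<in> F" "F \<subseteq> E" "U \<subseteq> V" "ends e = {u, v}" "u \<in> U" "v \<notin> U"
  shows "e \<in> edge_cut F ends U"
proof -
  have "v \<in> V" using assms ends_subset by blast
  then show ?thesis using assms edge_cut_iff[of e U] unfolding edge_cut_def by blast
qed

text \<open>Count incidences between \<open>U\<close> and \<open>F\<close>: an edge inside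
  \<open>U\<close> counts twice and an edge of the cut once, so modulo 2 the degrees in
  \<open>U\<close> add up to the size of the cut.\<close>

lemma odd_cut_iff:
  assumes "F \<subseteq> E" "U \<subseteq> V"
  shows "odd (card (edge_cut F ends U)) \<longleftrightarrow> odd (card (U \<inter> odd_set F))"
proof -
  have fin: "finite F" "finite U"
    using assms finite_edges finite_V finite_subset by blast+
  have eq: "(\<Sum>v\<in>U. card {e \<in> F. v \<in> ends e}) = (\<Sum>e\<in>F. card (ends e \<inter> U))"
    using fin by (intro sum_multicount_gen) (auto intro!: arg_cong[where f = card])
  have odd1: "odd (card (ends e \<inter> U)) \<longleftrightarrow> card (ends e \<inter> U) = 1" if "e \<in> F" for e
  proof -
    have "card (ends e) = 2" using that assms card_ends by auto
    then have "card (ends e \<inter> U) \<le> 2"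
      by (metis Int_lower1 card.infinite card_mono zero_neq_numeral)
    then consider "card (ends e \<inter> U) = 0" | "card (ends e \<inter> U) = 1" | "card (ends e \<inter> U) = 2"
      by linarith
    then show ?thesis by cases auto
  qed
  have "{e \<in> F. odd (card (ends e \<inter> U))} = edge_cut F ends U"
    unfolding edge_cut_def using odd1 by auto
  moreover have "{v \<in> U. odd (card {e \<in> F. v \<in> ends e})} = U \<inter> odd_set F"
    using assms by (auto simp: odd_set_def)
  ultimately show ?thesis
    using even_sum_iff[OF fin(1), of "\<lambda>e. card (ends e \<inter> U)"]
      even_sum_iff[OF fin(2), of "\<lambda>v. card {e \<in> F. v \<in> ends e}"] eq by simp
qed

lemma reach_subset: "F \<subseteq> E \<Longrightarrow> a \<in> V \<Longrightarrow> reach ends F a \<subseteq> V"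
proof
  fix v assume F: "F \<subseteq> E" "a \<in> V" and "v \<in> reach ends F a"
  then have "(a, v) \<in> (adj ends F)\<^sup>*" by (simp add: reach_iff)
  then show "v \<in> V"
    by (induction rule: rtrancl_induct) (use F ends_subset in auto)
qed

text \<open>A walk is summed modulo 2, so edges used twice cancel. The form
  \<open>sym_diff {a} {b}\<close> also covers \<open>a = b\<close>, where it is empty.\<close>

lemma path_join:
  assumes "(a, b) \<in> (adj ends F)\<^sup>*" "F \<subseteq> E"
  obtains Q where "Q \<subseteq> F" "odd_set Q = sym_diff {a} {b}"
proof -
  have "\<exists>Q\<subseteq>F. odd_set Q = sym_diff {a} {b}"
    using assms(1)
  proof (induction rule: rtrancl_induct)
    case base
    show ?case by (rule exI[of _ "{}"]) simp
  next
    case (step y z)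
    then obtain Q e where Q: "Q \<subseteq> F" "odd_set Q = sym_diff {a} {y}" and e: "e \<in> F" "ends e = {y, z}"
      by auto
    have "e \<in> E" "Q \<subseteq> E" using Q e assms(2) by auto
    then have "y \<noteq> z" "odd_set (sym_diff Q {e}) = sym_diff (sym_diff {a} {y}) {y, z}"
      using odd_set_toggle[of Q e y z] ends_distinct[of e y z] Q e by simp_all
    then have "odd_set (sym_diff Q {e}) = sym_diff {a} {z}" by auto
    then show ?case using Q e by (intro exI[of _ "sym_diff Q {e}"]) auto
  qed
  then show ?thesis using that by blast
qed

end

section \<open>Signed weights\<close>

definition signed_weight :: "('e \<Rightarrow> int) \<Rightarrow> 'e set \<Rightarrow> 'e set \<Rightarrow> int" where
  "signed_weight w J F = (\<Sum>e\<in>F. if e \<in> J then - w e else w e)"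

context multigraph
begin

text \<open>With every sum ranging over \<open>E\<close>, identities about symmetric differences can
  be checked edge by edge.\<close>

lemma signed_weight_indicator:
  assumes "F \<subseteq> E"
  shows "signed_weight w J F = (\<Sum>e\<in>E. if e \<in> F then if e \<in> J then - w e else w e else 0)"
  unfolding signed_weight_def using assms finite_E by (simp add: sum.If_cases Int_absorb1)

text \<open>Both sides compare \<open>J \<triangle> D \<triangle> F\<close> with
  \<open>J \<triangle> D\<close>; the right side goes by way of \<open>J\<close>.\<close>

lemma signed_weight_switch:
  assumes "D \<subseteq> E" "F \<subseteq> E"
  shows "signed_weight w (sym_diff J D) F = signed_weight w J (sym_diff F D) - signed_weight w J D"
proof -
  have "sym_diff F D \<subseteq> E" using assms by auto
  then show ?thesis using assms
    by (simp only: signed_weight_indicator sum_subtractf[symmetric]) (intro sum.cong, auto)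
qed

lemma signed_weight_zero:
  assumes "F \<subseteq> E" "W \<subseteq> E" "\<forall>e\<in>W. w e = 0"
  shows "signed_weight w J (sym_diff F W) = signed_weight w J F"
proof -
  have "sym_diff F W \<subseteq> E" using assms by auto
  then show ?thesis using assms
    by (simp only: signed_weight_indicator) (intro sum.cong, auto)
qed

lemma signed_weight_disjoint:
  assumes "F \<subseteq> E" "G \<subseteq> F"
  shows "signed_weight w J F = signed_weight w J G + signed_weight w J (F - G)"
  unfolding signed_weight_def using assms finite_edges by (simp add: sum.subset_diff add.commute)

text \<open>The toggled edge is either dropped with sign plus or added with sign minus, so the
  change is \<open>- w e\<close> in both cases.\<close>

lemma signed_weight_toggle:
  assumes "F \<subseteq> E" "e \<in> E" "(e \<in> F) \<noteq> (e \<in> J)"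
  shows "signed_weight w J (sym_diff F {e}) = signed_weight w J F - w e"
proof (cases "e \<in> F")
  case True
  then have "sym_diff F {e} = F - {e}" by auto
  then show ?thesis
    using True assms finite_edges[of F] by (simp add: signed_weight_def sum_diff1)
next
  case False
  then have "sym_diff F {e} = insert e F" by auto
  then show ?thesis
    using False assms finite_edges[of F] by (simp add: signed_weight_def)
qed

lemma even_signed_weight:
  assumes "F \<subseteq> E"
  shows "even (signed_weight w J F) \<longleftrightarrow> even (\<Sum>e\<in>F. w e)"
proof -
  have "finite F" using assms finite_edges by blast
  then show ?thesis unfolding signed_weight_def by (induction F) auto
qed

text \<open>\<open>J\<close> is conservative iff it has minimum weight among the edge sets with the same odd vertices:
  \<open>signed_weight w J D\<close> is the change of weight from \<open>J\<close> to its symmetric difference with \<open>D\<close>.\<close>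

definition conservative :: "('e \<Rightarrow> int) \<Rightarrow> 'e set \<Rightarrow> bool" where
  "conservative w J \<longleftrightarrow> (\<forall>D\<subseteq>E. odd_set D = {} \<longrightarrow> 0 \<le> signed_weight w J D)"

text \<open>The minimum is over all pairs of endpoints, not only over \<open>a\<close> and \<open>b\<close>.\<close>

definition min_path :: "('e \<Rightarrow> int) \<Rightarrow> 'e set \<Rightarrow> 'v \<Rightarrow> 'v \<Rightarrow> 'e set \<Rightarrow> bool" where
  "min_path w J a b P \<longleftrightarrow> a \<in> V \<and> b \<in> V \<and> P \<subseteq> E \<and> odd_set P = sym_diff {a} {b} \<and>
     (\<forall>a'\<in>V. \<forall>b'\<in>V. \<forall>P'\<subseteq>E. odd_set P' = sym_diff {a'} {b'} \<longrightarrow>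
        signed_weight w J P \<le> signed_weight w J P')"

text \<open>The part of \<open>D\<close> outside \<open>B\<close> that is reachable from \<open>x\<close> is left by \<open>D\<close> only into \<open>B\<close>.\<close>

lemma escape_edge:
  assumes D: "D \<subseteq> E" and B: "B \<subseteq> V" and x: "x \<in> V" "x \<notin> B"
  defines "F \<equiv> {e \<in> D. ends e \<inter> B = {}}"
  assumes e: "e \<in> edge_cut D ends (reach ends F x)"
  obtains v u Q where "e \<in> D" "ends e = {v, u}" "u \<in> B" "v \<in> V" "v \<notin> B"
    "Q \<subseteq> F" "odd_set Q = sym_diff {x} {v}"
proof -
  have FD: "F \<subseteq> D" "F \<subseteq> E" using D by (auto simp: F_def)
  have AV: "reach ends F x \<subseteq> V" using reach_subset[OF FD(2) x(1)] .
  have AB: "v \<notin> B" if "v \<in> reach ends F x" for v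
  proof -
    have "(x, v) \<in> (adj ends F)\<^sup>*" using that by (simp add: reach_iff)
    then show ?thesis
      by (induction rule: rtrancl_induct) (use x in \<open>auto simp: F_def\<close>)
  qed
  obtain v u where vu: "e \<in> D" "ends e = {v, u}" "v \<in> reach ends F x" "u \<in> V" "u \<notin> reach ends F x"
    using e D AV by (rule edge_cutE)
  have "u \<in> B"
  proof (rule ccontr)
    assume "u \<notin> B"
    then have "e \<in> F" using vu AB by (auto simp: F_def)
    then show False using vu reach_step by metis
  qed
  moreover obtain Q where "Q \<subseteq> F" "odd_set Q = sym_diff {x} {v}"
    using vu(3) FD(2) unfolding reach_iff by (rule path_join)
  moreover have "v \<in> V" "v \<notin> B" using vu(3) AV AB by auto
  ultimately show ?thesis using that vu(1,2) by meson
qed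

section \<open>Cuts around components of zero-weight edges\<close>

context
  fixes w :: "'e \<Rightarrow> int" and Z :: "'e set"
  assumes w_nonneg: "\<And>e. e \<in> E \<Longrightarrow> 0 \<le> w e"
  defines "Z \<equiv> {e \<in> E. w e = 0}"
begin

lemma Z_subset: "Z \<subseteq> E"
  by (auto simp: Z_def)

lemma zero_class_cut:
  assumes "b \<in> V" "e \<in> edge_cut E ends (reach ends Z b)"
  shows "0 < w e"
proof -
  obtain u v where uv: "e \<in> E" "ends e = {u, v}" "u \<in> reach ends Z b" "v \<in> V" "v \<notin> reach ends Z b"
    using assms(2) order_refl reach_subset[OF Z_subset assms(1)] by (rule edge_cutE)
  then have "e \<notin> Z" using reach_step by metis
  then show ?thesis using uv w_nonneg[of e] by (auto simp: Z_def)
qed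

text \<open>Lets an endpoint of a path move within its zero class without changing the signed weight
  or the edges in the surrounding cut.\<close>

lemma zero_path:
  assumes "b \<in> V" "u \<in> reach ends Z b" "v \<in> reach ends Z b"
  obtains W where "W \<subseteq> E" "odd_set W = sym_diff {u} {v}" "\<forall>e\<in>W. w e = 0"
    "W \<inter> edge_cut E ends (reach ends Z b) = {}"
proof -
  have "(u, v) \<in> (adj ends Z)\<^sup>*"
    using assms(3) unfolding reach_eq[OF assms(2), symmetric] reach_iff .
  then obtain W where W: "W \<subseteq> Z" "odd_set W = sym_diff {u} {v}"
    using Z_subset by (rule path_join)
  have "W \<inter> edge_cut E ends (reach ends Z b) = {}"
    using zero_class_cut[OF assms(1)] W(1) by (fastforce simp: Z_def)
  with W(1) show ?thesis by (intro that[OF _ W(2)]) (auto simp: Z_def)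
qed

text \<open>The class of an endpoint of a globally cheapest path takes the role of the vertex at which
  Sebo's proof of Seymour's T-join theorem contracts; keeping zero-weight edges instead of
  contracting them leaves the graph unchanged along the induction.\<close>

lemma min_path_cut:
  assumes cons: "conservative w J" and P: "min_path w J a b P" and neg: "signed_weight w J P < 0"
  defines "B \<equiv> reach ends Z b"
  shows "a \<notin> B" "P \<inter> edge_cut E ends B = J \<inter> edge_cut E ends B"
proof -
  have ab: "a \<in> V" "b \<in> V" "P \<subseteq> E" "odd_set P = sym_diff {a} {b}"
    and le: "\<And>a' b' P'. a' \<in> V \<Longrightarrow> b' \<in> V \<Longrightarrow> P' \<subseteq> E \<Longrightarrow> odd_set P' = sym_diff {a'} {b'} \<Longrightarrow>
      signed_weight w J P \<le> signed_weight w J P'"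
    using P unfolding min_path_def by blast+
  have BV: "B \<subseteq> V" unfolding B_def using reach_subset[OF Z_subset ab(2)] .
  show "a \<notin> B"
  proof
    \<comment> \<open>A zero-weight path from \<open>a\<close> to \<open>b\<close> would close
      \<open>P\<close> to an even set of negative signed weight.\<close>
    assume "a \<in> B"
    then obtain W where W: "W \<subseteq> E" "odd_set W = sym_diff {a} {b}" "\<forall>e\<in>W. w e = 0"
      "W \<inter> edge_cut E ends B = {}"
      unfolding B_def by (rule zero_path[OF ab(2) _ reach_refl])
    have "odd_set (sym_diff P W) = {}" "sym_diff P W \<subseteq> E"
      using ab W by (auto simp: odd_set_sym_diff)
    then have "0 \<le> signed_weight w J (sym_diff P W)"
      using cons unfolding conservative_def by blast
    then show False using signed_weight_zero[OF ab(3) W(1,3)] neg by simp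
  qed
  have "e \<in> P \<longleftrightarrow> e \<in> J" if e: "e \<in> edge_cut E ends B" for e
  proof (rule ccontr)
    \<comment> \<open>After the end of \<open>P\<close> is moved from \<open>b\<close> to
      \<open>u\<close> at no cost, toggling \<open>e\<close> moves it on to \<open>v\<close> and
      lowers the signed weight by \<open>w e > 0\<close>, against the minimality of
      \<open>P\<close>.\<close>
    assume neq: "(e \<in> P) \<noteq> (e \<in> J)"
    obtain u v where uv: "e \<in> E" "ends e = {u, v}" "u \<in> B" "v \<in> V" "v \<notin> B"
      using e order_refl BV by (rule edge_cutE)
    obtain W where W: "W \<subseteq> E" "odd_set W = sym_diff {b} {u}" "\<forall>e\<in>W. w e = 0"
      "W \<inter> edge_cut E ends B = {}"
      using uv(3) unfolding B_def by (rule zero_path[OF ab(2) reach_refl])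
    define P' where "P' = sym_diff P W"
    have P': "P' \<subseteq> E" "e \<in> P' \<longleftrightarrow> e \<in> P" using ab W e by (auto simp: P'_def)
    have "odd_set P' = sym_diff (sym_diff {a} {b}) (sym_diff {b} {u})"
      using ab W unfolding P'_def by (simp add: odd_set_sym_diff)
    then have "odd_set P' = sym_diff {a} {u}" by auto
    moreover have "u \<noteq> v" using uv by auto
    moreover have "odd_set (sym_diff P' {e}) = sym_diff (odd_set P') {u, v}"
      using P'(1) uv(1,2) by (rule odd_set_toggle)
    ultimately have "odd_set (sym_diff P' {e}) = sym_diff {a} {v}" by auto
    then have "signed_weight w J P \<le> signed_weight w J (sym_diff P' {e})"
      using le[of a v "sym_diff P' {e}"] ab uv P' by blast
    also have "\<dots> = signed_weight w J P' - w e"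
      using P' uv neq by (intro signed_weight_toggle) auto
    also have "signed_weight w J P' = signed_weight w J P"
      unfolding P'_def using ab W by (intro signed_weight_zero) auto
    finally show False using zero_class_cut[OF ab(2)] e unfolding B_def by fastforce
  qed
  then show "P \<inter> edge_cut E ends B = J \<inter> edge_cut E ends B" by blast
qed

text \<open>Cut \<open>P\<close> at an edge \<open>e\<close> by which it first reaches
  \<open>B\<close>. The rest, closed by a zero-weight path, is even and hence nonnegative, so the
  initial part is again globally cheapest. It has only \<open>e\<close> in the cut, and
  \<open>min_path_cut\<close> carries this over to \<open>J\<close>.\<close>

lemma min_path_one_edge:
  assumes cons: "conservative w J" and P: "min_path w J a b P" and neg: "signed_weight w J P < 0"
  defines "B \<equiv> reach ends Z b"
  obtains P' u e where "min_path w J a u P'" "u \<in> B" "signed_weight w J P' = signed_weight w J P"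
    "J \<inter> edge_cut E ends B = {e}"
proof -
  have ab: "a \<in> V" "b \<in> V" "P \<subseteq> E" "odd_set P = sym_diff {a} {b}"
    and le: "\<And>a' b' P'. a' \<in> V \<Longrightarrow> b' \<in> V \<Longrightarrow> P' \<subseteq> E \<Longrightarrow> odd_set P' = sym_diff {a'} {b'} \<Longrightarrow>
      signed_weight w J P \<le> signed_weight w J P'"
    using P unfolding min_path_def by blast+
  have BV: "B \<subseteq> V" unfolding B_def using reach_subset[OF Z_subset ab(2)] .
  have aB: "a \<notin> B" using min_path_cut(1)[OF cons P neg] unfolding B_def .
  define F where "F = {e \<in> P. ends e \<inter> B = {}}"
  define A where "A = reach ends F a"
  have FE: "F \<subseteq> E" using ab by (auto simp: F_def)
  have AV: "A \<subseteq> V" unfolding A_def using reach_subset[OF FE ab(1)] .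
  have bA: "b \<notin> A"
  proof
    assume "b \<in> A"
    moreover have "v \<notin> B" if "(a, v) \<in> (adj ends F)\<^sup>*" for v
      using that by (induction rule: rtrancl_induct) (use aB in \<open>auto simp: F_def\<close>)
    ultimately show False using reach_refl[of b ends Z] unfolding A_def reach_iff[of b ends F] B_def by blast
  qed
  \<comment> \<open>\<open>A\<close> contains \<open>a\<close> but not \<open>b\<close>, so by
    parity \<open>P\<close> must leave it.\<close>
  have "A \<inter> odd_set P = {a}" using bA ab unfolding A_def by auto
  then have "odd (card (edge_cut P ends A))" using odd_cut_iff[OF ab(3) AV] by simp
  then obtain e where "e \<in> edge_cut P ends A"
    by (metis card.empty even_zero ex_in_conv)
  then obtain v u Q where e: "e \<in> P" "ends e = {v, u}" "u \<in> B" "v \<in> V" "v \<notin> B"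
    "Q \<subseteq> F" "odd_set Q = sym_diff {a} {v}"
    unfolding A_def F_def by (rule escape_edge[OF ab(3) BV ab(1) aB])
  define P' where "P' = sym_diff Q {e}"
  have eQ: "e \<notin> Q" using e by (auto simp: F_def)
  have P'P: "P' \<subseteq> P" "P' \<subseteq> E" using e ab eQ by (auto simp: P'_def F_def)
  have QE: "Q \<subseteq> E" and eE: "e \<in> E" using e FE ab by auto
  have "odd_set P' = sym_diff (sym_diff {a} {v}) {v, u}"
    using odd_set_toggle[OF QE eE e(2)] unfolding P'_def e(7) .
  moreover have "v \<noteq> u" using e by auto
  ultimately have oP': "odd_set P' = sym_diff {a} {u}" by auto
  have uV: "u \<in> V" using e BV by auto
  obtain W where W: "W \<subseteq> E" "odd_set W = sym_diff {u} {b}" "\<forall>e\<in>W. w e = 0"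
    "W \<inter> edge_cut E ends B = {}"
    using e(3) unfolding B_def by (rule zero_path[OF ab(2) _ reach_refl])
  have PP': "P - P' \<subseteq> E" using ab by auto
  have "P - P' = sym_diff P P'" using P'P by auto
  then have "odd_set (P - P') = sym_diff (sym_diff {a} {b}) (sym_diff {a} {u})"
    using odd_set_sym_diff[OF ab(3) P'P(2)] ab(4) oP' by simp
  then have oR: "odd_set (P - P') = sym_diff {b} {u}" by auto
  have "odd_set (sym_diff (P - P') W) = {}"
    using odd_set_sym_diff[OF PP' W(1)] W(2) oR by auto
  moreover have "sym_diff (P - P') W \<subseteq> E" using PP' W(1) by auto
  ultimately have "0 \<le> signed_weight w J (sym_diff (P - P') W)"
    using cons unfolding conservative_def by blast
  then have "0 \<le> signed_weight w J (P - P')"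
    using signed_weight_zero[OF PP' W(1,3)] by simp
  then have "signed_weight w J P' \<le> signed_weight w J P"
    using signed_weight_disjoint[OF ab(3) P'P(1)] by simp
  then have eq: "signed_weight w J P' = signed_weight w J P"
    using le[OF ab(1) uV P'P(2) oP'] by simp
  then have P'min: "min_path w J a u P'"
    unfolding min_path_def using ab(1) uV P'P(2) oP' le by simp
  have Bu: "reach ends Z u = B" using e(3) unfolding B_def by (rule reach_eq)
  have "J \<inter> edge_cut E ends B = P' \<inter> edge_cut E ends B"
    using min_path_cut(2)[OF cons P'min] eq neg Bu by simp
  also have "\<dots> = {e}"
  proof -
    have "e \<in> edge_cut E ends B"
      using edge_cutI[of e E B u v] e ab BV by (auto simp: insert_commute)
    moreover have "f \<notin> edge_cut E ends B" if "f \<in> Q" for f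
      using that e(6) unfolding F_def edge_cut_def by auto
    ultimately show ?thesis by (auto simp: P'_def)
  qed
  finally show ?thesis using that P'min e(3) eq by blast
qed

text \<open>If \<open>D\<close> has signed weight 0, then \<open>J \<triangle> D\<close> is again minimum, with the same cheapest paths up to
  switching along \<open>D\<close>; hence it also has a single edge in the cut.\<close>

lemma switched_cut:
  assumes cons: "conservative w J" and J: "J \<subseteq> E"
    and P: "min_path w J a b P" and neg: "signed_weight w J P < 0"
    and D: "D \<subseteq> E" "odd_set D = {}" "signed_weight w J D = 0"
  obtains e where "sym_diff J D \<inter> edge_cut E ends (reach ends Z b) = {e}"
proof -
  have switch: "signed_weight w (sym_diff J D) F = signed_weight w J (sym_diff F D)"
    if "F \<subseteq> E" for F
    using signed_weight_switch[OF D(1) that] D(3) by simp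
  have odd_D: "odd_set (sym_diff F D) = odd_set F" if "F \<subseteq> E" for F
    using odd_set_sym_diff[OF that D(1)] D(2) by simp
  have sub: "sym_diff F D \<subseteq> E" if "F \<subseteq> E" for F
    using that D(1) by auto
  have PE: "P \<subseteq> E" using P unfolding min_path_def by blast
  have PDD: "sym_diff (sym_diff P D) D = P" by auto
  have "conservative w (sym_diff J D)"
    unfolding conservative_def
  proof (intro allI impI)
    fix F assume "F \<subseteq> E" "odd_set F = {}"
    then show "0 \<le> signed_weight w (sym_diff J D) F"
      using cons switch[of F] odd_D[of F] sub[of F] unfolding conservative_def by simp
  qed
  moreover have wP: "signed_weight w (sym_diff J D) (sym_diff P D) = signed_weight w J P"
    using switch[OF sub[OF PE]] unfolding PDD .
  moreover have "min_path w (sym_diff J D) a b (sym_diff P D)"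
    unfolding min_path_def wP
  proof (intro conjI ballI allI impI)
    show "a \<in> V" "b \<in> V" "sym_diff P D \<subseteq> E" "odd_set (sym_diff P D) = sym_diff {a} {b}"
      using P sub[OF PE] odd_D[OF PE] unfolding min_path_def by simp_all
    fix a' b' P'
    assume "a' \<in> V" "b' \<in> V" and P': "P' \<subseteq> E" "odd_set P' = sym_diff {a'} {b'}"
    then have "signed_weight w J P \<le> signed_weight w J (sym_diff P' D)"
      using P sub[OF P'(1)] odd_D[OF P'(1)] unfolding min_path_def by metis
    then show "signed_weight w J P \<le> signed_weight w (sym_diff J D) P'"
      using switch[OF P'(1)] by simp
  qed
  ultimately show ?thesis
    using that neg by (metis min_path_one_edge)
qed

text \<open>Leave \<open>B\<close> along \<open>f\<close>. Since \<open>D\<close> is even, the part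
  of \<open>D\<close> outside \<open>B\<close> at the far end of \<open>f\<close> is left by a
  second edge \<open>g\<close>; the trail \<open>f\<close>, \<open>Q\<close>, \<open>g\<close> runs
  from \<open>B\<close> back to \<open>B\<close>. One zero-weight path closes both this trail and
  the rest of \<open>D\<close>.\<close>

lemma split_at_class:
  assumes b: "b \<in> V" and D: "D \<subseteq> E" "odd_set D = {}"
  defines "X \<equiv> edge_cut E ends (reach ends Z b)"
  assumes ne: "D \<inter> X \<noteq> {}"
  obtains D1 D2 where "D1 \<subseteq> E" "odd_set D1 = {}" "D2 \<subseteq> E" "odd_set D2 = {}"
    "card (D1 \<inter> X) = 2" "D1 \<inter> X \<subseteq> D \<inter> X" "D2 \<inter> X = D \<inter> X - D1 \<inter> X"
    "signed_weight w J D = signed_weight w J D1 + signed_weight w J D2"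
proof -
  define B where "B = reach ends Z b"
  have BV: "B \<subseteq> V" unfolding B_def using reach_subset[OF Z_subset b] .
  have XB: "X = edge_cut E ends B" unfolding X_def B_def ..
  obtain f where f: "f \<in> D" "f \<in> edge_cut E ends B" using ne XB by auto
  obtain u x where ux: "f \<in> E" "ends f = {u, x}" "u \<in> B" "x \<in> V" "x \<notin> B"
    using f(2) order_refl BV by (rule edge_cutE)
  define F where "F = {e \<in> D. ends e \<inter> B = {}}"
  define A where "A = reach ends F x"
  have FE: "F \<subseteq> E" using D by (auto simp: F_def)
  have AV: "A \<subseteq> V" unfolding A_def using reach_subset[OF FE ux(4)] .
  have xA: "x \<in> A" by (simp add: A_def)
  have uA: "u \<notin> A"
  proof
    assume "u \<in> A"
    moreover have "v \<notin> B" if "(x, v) \<in> (adj ends F)\<^sup>*" for v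
      using that by (induction rule: rtrancl_induct) (use ux in \<open>auto simp: F_def\<close>)
    ultimately show False using ux(3) unfolding A_def reach_iff by blast
  qed
  have finA: "finite (edge_cut D ends A)"
    using finite_edges[OF D(1)] by (simp add: edge_cut_def)
  have "f \<in> edge_cut D ends A"
    using edge_cutI[OF f(1) D(1) AV _ xA uA] ux(2) by (simp add: insert_commute)
  moreover have "even (card (edge_cut D ends A))"
    using odd_cut_iff[OF D(1) AV] D(2) by simp
  ultimately have "edge_cut D ends A \<noteq> {f}" "edge_cut D ends A \<noteq> {}" "f \<in> edge_cut D ends A"
    by auto
  then obtain g where g: "g \<in> edge_cut D ends A" "g \<noteq> f" by blast
  obtain v u' Q where e: "g \<in> D" "ends g = {v, u'}" "u' \<in> B" "v \<in> V" "v \<notin> B"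
    "Q \<subseteq> F" "odd_set Q = sym_diff {x} {v}"
    using g(1) unfolding A_def F_def by (rule escape_edge[OF D(1) BV ux(4,5)])
  have gX: "g \<in> edge_cut E ends B"
    using edge_cutI[of g E B u' v] e D BV by (auto simp: insert_commute)
  have QX: "Q \<inter> edge_cut E ends B = {}"
    using e(6) unfolding F_def edge_cut_def by auto
  have QE: "Q \<subseteq> E" using e FE by auto
  have fgQ: "f \<notin> Q" "g \<notin> Q" using QX f(2) gX by auto
  define C where "C = sym_diff (sym_diff Q {f}) {g}"
  have C_eq: "C = insert f (insert g Q)" using fgQ g(2) by (auto simp: C_def)
  have CD: "C \<subseteq> D" using C_eq f e by (auto simp: F_def)
  then have CE: "C \<subseteq> E" using D by blast
  have QfE: "sym_diff Q {f} \<subseteq> E" "g \<in> E" using QE ux e D by auto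
  have "odd_set C = sym_diff (sym_diff (sym_diff {x} {v}) {u, x}) {v, u'}"
    unfolding C_def odd_set_toggle[OF QfE e(2)] odd_set_toggle[OF QE ux(1,2)] e(7) ..
  moreover have "u \<noteq> x" "v \<noteq> u'" "u \<noteq> v" "x \<noteq> u'" using ux e by auto
  ultimately have oC: "odd_set C = sym_diff {u} {u'}" by auto
  obtain W where W: "W \<subseteq> E" "odd_set W = sym_diff {u} {u'}" "\<forall>e\<in>W. w e = 0"
    "W \<inter> edge_cut E ends B = {}"
    using ux(3) e(3) unfolding B_def by (rule zero_path[OF b])
  have DC: "D - C = sym_diff D C" "D - C \<subseteq> E" using CD D by auto
  have oDC: "odd_set (D - C) = sym_diff {u} {u'}"
    using odd_set_sym_diff[OF D(1) CE] unfolding DC(1)[symmetric] by (simp add: D(2) oC)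
  show ?thesis
  proof (rule that[of "sym_diff C W" "sym_diff (D - C) W"])
    show "sym_diff C W \<subseteq> E" "sym_diff (D - C) W \<subseteq> E"
      using CE W(1) D(1) by auto
    show "odd_set (sym_diff C W) = {}"
      unfolding odd_set_sym_diff[OF CE W(1)] oC W(2) by auto
    show "odd_set (sym_diff (D - C) W) = {}"
      unfolding odd_set_sym_diff[OF DC(2) W(1)] oDC W(2) by auto
    have "sym_diff C W \<inter> X = {f, g}"
      using f(2) gX QX W(4) unfolding C_eq XB by blast
    then show "card (sym_diff C W \<inter> X) = 2" using g(2) by simp
    show "sym_diff C W \<inter> X \<subseteq> D \<inter> X" "sym_diff (D - C) W \<inter> X = D \<inter> X - sym_diff C W \<inter> X"
      using W(4) CD unfolding XB by blast+
    show "signed_weight w J D = signed_weight w J (sym_diff C W) + signed_weight w J (sym_diff (D - C) W)"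
      unfolding signed_weight_zero[OF CE W(1,3)] signed_weight_zero[OF DC(2) W(1,3)]
      using D(1) CD by (rule signed_weight_disjoint)
  qed
qed

text \<open>The reduction changes the signed weight of an even \<open>D\<close> by
  \<open>- card (D \<inter> X)\<close>, plus 2 if \<open>e\<close> is in \<open>D\<close>. Splitting
  leaves \<open>card (D \<inter> X) = 2\<close> with \<open>e\<close> outside \<open>D\<close> as
  the only critical case; there weight 0 is excluded by \<open>switched_cut\<close>, and evenness
  then gives at least 2.\<close>

lemma conservative_reduce:
  assumes cons: "conservative w J" and J: "J \<subseteq> E"
    and P: "min_path w J a b P" and neg: "signed_weight w J P < 0"
    and even_w: "\<And>D. D \<subseteq> E \<Longrightarrow> odd_set D = {} \<Longrightarrow> even (sum w D)"
  defines "X \<equiv> edge_cut E ends (reach ends Z b)"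
  assumes e: "J \<inter> X = {e}"
  shows "conservative (\<lambda>e. w e - (if e \<in> X then 1 else 0)) J"
proof -
  have b: "b \<in> V" using P unfolding min_path_def by blast
  have finX: "finite X" unfolding X_def edge_cut_def using finite_E by simp
  have eX: "e \<in> X" using e by blast
  let ?w = "\<lambda>e. w e - (if e \<in> X then 1 else 0)"
  have sw: "signed_weight ?w J D = signed_weight w J D - int (card (D \<inter> X)) + (if e \<in> D then 2 else 0)"
    if D: "D \<subseteq> E" for D
  proof -
    have fin: "finite D" using D finite_edges by blast
    have "signed_weight w J D - signed_weight ?w J D
        = (\<Sum>f\<in>D. if f \<in> X then if f \<in> J then -1 else 1 else 0)"
      unfolding signed_weight_def sum_subtractf[symmetric] by (intro sum.cong) auto
    also have "\<dots> = (\<Sum>f\<in>D \<inter> X. if f \<in> J then -1 else 1)"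
      using fin by (simp add: sum.inter_restrict)
    also have "\<dots> = (\<Sum>f\<in>D \<inter> X. 1 - (if f = e then 2 else 0))"
      using e by (intro sum.cong) auto
    also have "\<dots> = int (card (D \<inter> X)) - (if e \<in> D then 2 else 0)"
      using fin eX by (simp add: sum_subtractf)
    finally show ?thesis by (simp split: if_splits)
  qed
  have main: "0 \<le> signed_weight ?w J D" if "D \<subseteq> E" "odd_set D = {}" for D
    using that
  proof (induction "card (D \<inter> X)" arbitrary: D rule: less_induct)
    case less
    have c0: "0 \<le> signed_weight w J D" using cons less.prems unfolding conservative_def by blast
    have fin: "finite (D \<inter> X)" using finX by simp
    have two: "0 \<le> signed_weight ?w J D" if "card (D \<inter> X) = 2"
    proof (cases "e \<in> D")
      case True
      then show ?thesis using sw[OF less.prems(1)] that c0 by simp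
    next
      case False
      have "signed_weight w J D \<noteq> 0"
      proof
        assume "signed_weight w J D = 0"
        then obtain g where g: "sym_diff J D \<inter> X = {g}"
          unfolding X_def by (rule switched_cut[OF cons J P neg less.prems])
        have "g \<in> X \<Longrightarrow> g \<in> J \<longleftrightarrow> g = e" for g using e by blast
        \<comment> \<open>\<open>J\<close> and \<open>D\<close> are disjoint on \<open>X\<close>, so
          \<open>J \<triangle> D\<close> would have three edges there instead of one.\<close>
        then have "sym_diff J D \<inter> X = insert e (D \<inter> X)" using eX False by blast
        then have g': "insert e (D \<inter> X) = {g}" unfolding g by (rule sym)
        have "card (insert e (D \<inter> X)) = 1" unfolding g' by simp
        then show False using that False fin by simp
      qed
      moreover have "even (signed_weight w J D)"
        using even_signed_weight[OF less.prems(1)] even_w[OF less.prems] by simp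
      ultimately have "2 \<le> signed_weight w J D" using c0 by presburger
      then show ?thesis using sw[OF less.prems(1)] that False by simp
    qed
    show ?case
    proof (cases "D \<inter> X = {}")
      case True
      then show ?thesis using sw[OF less.prems(1)] c0 eX by auto
    next
      case False
      show ?thesis
      proof (cases "card (D \<inter> X) = 2")
        case True
        then show ?thesis by (rule two)
      next
        case neq: False
        obtain D1 D2 where D12: "D1 \<subseteq> E" "odd_set D1 = {}" "D2 \<subseteq> E" "odd_set D2 = {}"
          "card (D1 \<inter> X) = 2" "D1 \<inter> X \<subseteq> D \<inter> X" "D2 \<inter> X = D \<inter> X - D1 \<inter> X"
          "signed_weight w J D = signed_weight w J D1 + signed_weight w J D2"
          using False unfolding X_def by (rule split_at_class[OF b less.prems])
        have card2: "card (D2 \<inter> X) = card (D \<inter> X) - 2" "2 \<le> card (D \<inter> X)"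
          using D12(5-7) fin card_mono[OF fin D12(6)] finite_subset[OF D12(6) fin]
          by (simp_all add: card_Diff_subset)
        then have "0 \<le> signed_weight ?w J D1" "0 \<le> signed_weight ?w J D2"
          using less.hyps[OF _ D12(1,2)] less.hyps[OF _ D12(3,4)] D12(5) neq by simp_all
        \<comment> \<open>\<open>e\<close> falls into exactly one piece if it is in
          \<open>D\<close>, so the correction of 2 is not counted twice.\<close>
        moreover have "e \<in> D \<longleftrightarrow> e \<in> D1 \<or> e \<in> D2" "\<not> (e \<in> D1 \<and> e \<in> D2)"
          using D12(6,7) eX by blast+
        ultimately show ?thesis
          using sw[OF less.prems(1)] sw[OF D12(1)] sw[OF D12(3)] D12(5,8) card2
          by (simp split: if_splits)
      qed
    qed
  qed
  then show ?thesis unfolding conservative_def by blast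
qed

end

end

section \<open>Minimum T-joins\<close>

context multigraph
begin

lemma edge_cut_Int: "F \<subseteq> E \<Longrightarrow> edge_cut F ends U = F \<inter> edge_cut E ends U"
  unfolding edge_cut_def by blast

lemma sum_reduce:
  assumes "finite D"
  shows "(\<Sum>e\<in>D. w e - (if e \<in> X then 1 else 0 :: int)) = sum w D - int (card (D \<inter> X))"
  using sum.inter_restrict[OF assms, of "\<lambda>_. 1 :: int" X] by (simp add: sum_subtractf)

text \<open>Lowering the weights on one T-cut by 1 lowers the weight of \<open>J\<close> by 1 and the total weight by at
  least \<open>k\<close>. Evenness of the weight of all cycles plays the role of bipartiteness.\<close>

theorem T_join_weight_le:
  fixes w :: "'e \<Rightarrow> int" and k :: int
  assumes J: "J \<subseteq> E"
    and cuts: "\<And>U. U \<subseteq> V \<Longrightarrow> odd (card (U \<inter> odd_set J)) \<Longrightarrow> k \<le> int (card (edge_cut E ends U))"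
    and w_nonneg: "\<And>e. e \<in> E \<Longrightarrow> 0 \<le> w e"
    and even_w: "\<And>D. D \<subseteq> E \<Longrightarrow> odd_set D = {} \<Longrightarrow> even (sum w D)"
    and cons: "conservative w J"
  shows "k * sum w J \<le> sum w E"
  using w_nonneg even_w cons
proof (induction "nat (sum w E)" arbitrary: w rule: less_induct)
  case less
  note w_nonneg = less.prems(1) and even_w = less.prems(2) and cons = less.prems(3)
  have finJ: "finite J" using J finite_edges by blast
  show ?case
  proof (cases "\<exists>e\<in>J. 0 < w e")
    case False
    then have "w e = 0" if "e \<in> J" for e
      using that J w_nonneg[of e] by force
    then have "sum w J = 0" by (intro sum.neutral) auto
    then show ?thesis using w_nonneg by (simp add: sum_nonneg)
  next
    case True
    then obtain e0 where e0: "e0 \<in> J" "0 < w e0" by blast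
    \<comment> \<open>\<open>S\<close> allows all pairs of endpoints; a single edge of
      \<open>J\<close> with positive weight is a candidate, so the minimum is negative.\<close>
    define S where "S = {P. P \<subseteq> E \<and> (\<exists>a\<in>V. \<exists>b\<in>V. odd_set P = sym_diff {a} {b})}"
    have finS: "finite S" unfolding S_def using finite_E by simp
    have e0E: "e0 \<in> E" using e0 J by blast
    then obtain x y where xy: "ends e0 = {x, y}" "x \<noteq> y"
      using card_ends[OF e0E] unfolding card_2_iff by blast
    have "odd_set {e0} = sym_diff {x} {y}" "x \<in> V" "y \<in> V"
      using odd_set_single[OF e0E] ends_subset[OF e0E] xy by auto
    then have e0S: "{e0} \<in> S" unfolding S_def using e0E by blast
    have "Min (signed_weight w J ` S) \<in> signed_weight w J ` S"
      using finS e0S by (intro Min_in) auto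
    then obtain P where P: "P \<in> S" "signed_weight w J P = Min (signed_weight w J ` S)"
      by auto
    have P_le: "signed_weight w J P \<le> signed_weight w J P'" if "P' \<in> S" for P'
      unfolding P(2) using finS that by simp
    have "signed_weight w J {e0} = - w e0" using e0 by (simp add: signed_weight_def)
    then have neg: "signed_weight w J P < 0" using P_le[OF e0S] e0 by simp
    obtain a b where ab: "a \<in> V" "b \<in> V" "P \<subseteq> E" "odd_set P = sym_diff {a} {b}"
      using P(1) unfolding S_def by blast
    have "signed_weight w J P \<le> signed_weight w J P'"
      if "a' \<in> V" "b' \<in> V" "P' \<subseteq> E" "odd_set P' = sym_diff {a'} {b'}" for a' b' P'
      by (rule P_le) (use that in \<open>unfold S_def, blast\<close>)
    with ab have mp: "min_path w J a b P" unfolding min_path_def by simp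
    define B where "B = reach ends {e \<in> E. w e = 0} b"
    define X where "X = edge_cut E ends B"
    have BV: "B \<subseteq> V" unfolding B_def by (rule reach_subset) (use ab in auto)
    have finX: "finite X" "X \<subseteq> E" using finite_E unfolding X_def edge_cut_def by auto
    obtain e where e: "J \<inter> X = {e}"
      using min_path_one_edge[OF w_nonneg cons mp neg] unfolding X_def B_def by metis
    define w' where "w' = (\<lambda>e. w e - (if e \<in> X then 1 else 0))"
    have sum_w': "sum w' D = sum w D - int (card (D \<inter> X))" if "D \<subseteq> E" for D
      unfolding w'_def using sum_reduce finite_edges[OF that] by blast
    have pos: "0 < w e" if "e \<in> X" for e
      using w_nonneg ab(2) that unfolding X_def B_def by (rule zero_class_cut)
    have "conservative w' J"
      unfolding w'_def X_def B_def
      by (rule conservative_reduce[OF w_nonneg cons J mp neg even_w e[unfolded X_def B_def]])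
    moreover have "0 \<le> w' e" if "e \<in> E" for e
      using w_nonneg[OF that] pos[of e] unfolding w'_def by (cases "e \<in> X") auto
    \<comment> \<open>An even set meets every cut in an even number of edges, so evenness survives
      the reduction.\<close>
    moreover have "even (sum w' D)" if "D \<subseteq> E" "odd_set D = {}" for D
      using sum_w'[OF that(1)] even_w[OF that] odd_cut_iff[OF that(1) BV] that(2)
      unfolding X_def edge_cut_Int[OF that(1), symmetric] by simp
    moreover have sumE: "sum w' E = sum w E - int (card X)"
      using sum_w'[OF order_refl] finX(2) by (simp add: Int_absorb1)
    moreover have sumJ: "sum w' J = sum w J - 1" using sum_w'[OF J] e by simp
    \<comment> \<open>A nonempty cut and a nonnegative total make the measure
      \<open>nat (sum w E)\<close> drop.\<close>
    moreover have "card X > 0" using e finX(1) by (auto simp: card_gt_0_iff)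
    moreover have "0 \<le> sum w' E" using \<open>\<And>e. e \<in> E \<Longrightarrow> 0 \<le> w' e\<close> by (rule sum_nonneg)
    ultimately have IH: "k * sum w' J \<le> sum w' E"
      by (intro less.hyps) auto
    \<comment> \<open>Meeting \<open>J\<close> in exactly one edge makes the cut a T-cut by parity,
      so the bound \<open>k\<close> applies to it.\<close>
    have "card (edge_cut J ends B) = 1"
      unfolding edge_cut_Int[OF J] using e unfolding X_def by simp
    then have "odd (card (B \<inter> odd_set J))" using odd_cut_iff[OF J BV] by simp
    then have "k \<le> int (card X)" unfolding X_def using cuts[OF BV] by simp
    then show ?thesis using IH sumE sumJ by (simp add: algebra_simps)
  qed
qed

lemma min_T_join_conservative:
  assumes J: "J \<subseteq> E"
    and min: "\<And>J'. J' \<subseteq> E \<Longrightarrow> odd_set J' = odd_set J \<Longrightarrow> sum w J \<le> sum w J'"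
  shows "conservative w J"
  unfolding conservative_def
proof (intro allI impI)
  fix D assume D: "D \<subseteq> E" "odd_set D = {}"
  have "odd_set (sym_diff J D) = odd_set J" "sym_diff J D \<subseteq> E"
    using odd_set_sym_diff[OF J D(1)] D J by auto
  then have le: "sum w J \<le> sum w (sym_diff J D)" using min by blast
  have ind: "sum w F = (\<Sum>e\<in>E. if e \<in> F then w e else 0)" if "F \<subseteq> E" for F
    using that finite_E by (simp add: sum.If_cases Int_absorb1)
  have "sum w (sym_diff J D) - sum w J = signed_weight w J D"
    unfolding ind[OF \<open>sym_diff J D \<subseteq> E\<close>] ind[OF J] signed_weight_indicator[OF D(1)]
      sum_subtractf[symmetric]
    by (intro sum.cong) auto
  then show "0 \<le> signed_weight w J D" using le by simp
qed

text \<open>Let \<open>J\<close> be of minimum weight among the sets with the same odd vertices as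
  \<open>E\<close>. Its weight is at most a third of the total, which forces it to meet each 3-cut
  just once and to avoid \<open>f\<close>; the complement is then as required.\<close>

lemma even_set_three_cuts:
  assumes cuts: "\<And>U. U \<subseteq> V \<Longrightarrow> odd (card (edge_cut E ends U)) \<Longrightarrow> 3 \<le> card (edge_cut E ends U)"
  obtains D where "D \<subseteq> E" "odd_set D = {}" "f \<in> E \<longrightarrow> f \<in> D"
    "\<forall>U\<subseteq>V. card (edge_cut E ends U) = 3 \<longrightarrow> D \<inter> edge_cut E ends U \<noteq> {}"
proof -
  define \<C> where "\<C> = {U. U \<subseteq> V \<and> card (edge_cut E ends U) = 3}"
  have fin\<C>: "finite \<C>" unfolding \<C>_def using finite_V by simp
  \<comment> \<open>The factor 2 makes the weights of all cycles even, as
    \<open>T_join_weight_le\<close> requires; the extra unit on \<open>f\<close> is what keeps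
    \<open>f\<close> out of \<open>J\<close>.\<close>
  define w :: "'e \<Rightarrow> int" where
    "w e = 2 * (int (card {U \<in> \<C>. e \<in> edge_cut E ends U}) + (if e = f then 1 else 0))" for e
  have sum_w: "sum w F = 2 * ((\<Sum>U\<in>\<C>. int (card (F \<inter> edge_cut E ends U))) + (if f \<in> F then 1 else 0))"
    if "F \<subseteq> E" for F
  proof -
    have fin: "finite F" using that finite_edges by blast
    have "(\<Sum>e\<in>F. card {U \<in> \<C>. e \<in> edge_cut E ends U}) = (\<Sum>U\<in>\<C>. card (F \<inter> edge_cut E ends U))"
      using fin fin\<C> by (intro sum_multicount_gen) (auto simp: Collect_conj_eq)
    then show ?thesis
      using fin unfolding w_def sum_distrib_left[symmetric] sum.distrib
      by (simp flip: of_nat_sum)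
  qed
  define \<J> where "\<J> = {J. J \<subseteq> E \<and> odd_set J = odd_set E}"
  have fin\<J>: "finite \<J>" "E \<in> \<J>" unfolding \<J>_def using finite_E by auto
  have "Min (sum w ` \<J>) \<in> sum w ` \<J>" using fin\<J> by (intro Min_in) auto
  then obtain J where J: "J \<subseteq> E" "odd_set J = odd_set E" "sum w J = Min (sum w ` \<J>)"
    unfolding \<J>_def by auto
  have cons: "conservative w J"
  proof (rule min_T_join_conservative[OF J(1)])
    fix J' assume "J' \<subseteq> E" "odd_set J' = odd_set J"
    then have "J' \<in> \<J>" unfolding \<J>_def using J by simp
    then show "sum w J \<le> sum w J'" unfolding J(3) using fin\<J> by simp
  qed
  have "3 * sum w J \<le> sum w E"
  proof (rule T_join_weight_le[OF J(1) _ _ _ cons])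
    fix U assume U: "U \<subseteq> V" "odd (card (U \<inter> odd_set J))"
    then have "odd (card (edge_cut E ends U))" using odd_cut_iff[OF order_refl U(1)] J(2) by simp
    then show "3 \<le> int (card (edge_cut E ends U))" using cuts[OF U(1)] by simp
  next
    show "0 \<le> w e" for e by (simp add: w_def)
    show "even (sum w D)" if "D \<subseteq> E" for D using sum_w[OF that] by simp
  qed
  moreover have "sum w E \<le> 2 * (3 * int (card \<C>) + 1)"
  proof -
    have "E \<inter> edge_cut E ends U = edge_cut E ends U" for U
      unfolding edge_cut_def by auto
    then have "(\<Sum>U\<in>\<C>. int (card (E \<inter> edge_cut E ends U))) = 3 * int (card \<C>)"
      by (simp add: \<C>_def)
    then show ?thesis using sum_w[OF order_refl] by simp
  qed
  moreover have odd_J: "odd (card (J \<inter> edge_cut E ends U))" if "U \<in> \<C>" for U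
  proof -
    have U: "U \<subseteq> V" "card (edge_cut E ends U) = 3" using that by (auto simp: \<C>_def)
    then show ?thesis
      using odd_cut_iff[OF J(1) U(1)] odd_cut_iff[OF order_refl U(1)] J(2)
      unfolding edge_cut_Int[OF J(1), symmetric] by simp
  qed
  \<comment> \<open>Division by 6 gives the bound \<open>card \<C> + 1/3\<close>, which integrality
    rounds down. Each 3-cut contributes an odd number, so at least 1, and nothing is left for
    \<open>f\<close>.\<close>
  ultimately have le: "(\<Sum>U\<in>\<C>. int (card (J \<inter> edge_cut E ends U))) + (if f \<in> J then 1 else 0) \<le> int (card \<C>)"
    using sum_w[OF J(1)] by (simp split: if_splits)
  have ge1: "1 \<le> int (card (J \<inter> edge_cut E ends U))" if "U \<in> \<C>" for U
    using odd_J[OF that] by (simp add: Suc_le_eq odd_pos)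
  then have "(\<Sum>U\<in>\<C>. 1) \<le> (\<Sum>U\<in>\<C>. int (card (J \<inter> edge_cut E ends U)))"
    by (rule sum_mono)
  then have fJ: "f \<notin> J" and eq: "(\<Sum>U\<in>\<C>. int (card (J \<inter> edge_cut E ends U))) = (\<Sum>U\<in>\<C>. 1)"
    using le by (simp_all split: if_splits)
  have one: "card (J \<inter> edge_cut E ends U) = 1" if "U \<in> \<C>" for U
  proof (rule ccontr)
    assume "card (J \<inter> edge_cut E ends U) \<noteq> 1"
    then have "1 < int (card (J \<inter> edge_cut E ends U))" using ge1[OF that] by simp
    then have "(\<Sum>U\<in>\<C>. 1) < (\<Sum>U\<in>\<C>. int (card (J \<inter> edge_cut E ends U)))"
      using fin\<C> that ge1 by (intro sum_strict_mono_ex1) auto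
    then show False using eq by simp
  qed
  show ?thesis
  proof (rule that[of "E - J"])
    show "E - J \<subseteq> E" by auto
    have "E - J = sym_diff E J" using J by auto
    then show "odd_set (E - J) = {}"
      using odd_set_sym_diff[OF order_refl J(1)] J(2) by simp
    show "f \<in> E \<longrightarrow> f \<in> E - J" using fJ by simp
    have "(E - J) \<inter> edge_cut E ends U \<noteq> {}" if "U \<subseteq> V" "card (edge_cut E ends U) = 3" for U
    proof -
      have "card (J \<inter> edge_cut E ends U) = 1" using that one by (simp add: \<C>_def)
      then have "\<not> edge_cut E ends U \<subseteq> J" using that(2) by (auto simp: Int_absorb1)
      then show ?thesis unfolding edge_cut_def by blast
    qed
    then show "\<forall>U\<subseteq>V. card (edge_cut E ends U) = 3 \<longrightarrow> (E - J) \<inter> edge_cut E ends U \<noteq> {}"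
      by blast
  qed
qed

end

section \<open>Matroid union\<close>

text \<open>A finite matroid given by its closure operator; \<open>cl_closed\<close> combines
  monotonicity and idempotence.\<close>

locale matroid_closure =
  fixes M :: "'e set" and cl :: "'e set \<Rightarrow> 'e set"
  assumes finite_M: "finite M"
    and cl_subset: "cl F \<subseteq> M"
    and cl_extensive: "F \<subseteq> M \<Longrightarrow> F \<subseteq> cl F"
    and cl_closed: "F \<subseteq> cl G \<Longrightarrow> cl F \<subseteq> cl G"
    and cl_exchange: "e \<in> cl (insert f F) \<Longrightarrow> f \<in> M \<Longrightarrow> F \<subseteq> M \<Longrightarrow> e \<notin> cl F \<Longrightarrow> f \<in> cl (insert e F)"
begin

definition indep :: "'e set \<Rightarrow> bool" where
  "indep F \<longleftrightarrow> F \<subseteq> M \<and> (\<forall>e\<in>F. e \<notin> cl (F - {e}))"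

lemma cl_mono: "F \<subseteq> G \<Longrightarrow> G \<subseteq> M \<Longrightarrow> cl F \<subseteq> cl G"
  using cl_closed cl_extensive by blast

lemma indep_subset:
  assumes "indep F" "G \<subseteq> F"
  shows "indep G"
proof -
  have "cl (G - {e}) \<subseteq> cl (F - {e})" for e
    using assms by (intro cl_mono) (auto simp: indep_def)
  then show ?thesis using assms unfolding indep_def by blast
qed

text \<open>If some \<open>f\<close> in \<open>F\<close> became redundant, exchange would put
  \<open>e\<close> into the closure of \<open>F\<close>.\<close>

lemma indep_insert:
  assumes "indep F" "e \<in> M" "e \<notin> cl F"
  shows "indep (insert e F)"
proof -
  have FM: "F \<subseteq> M" using assms by (simp add: indep_def)
  then have eF: "e \<notin> F" using assms cl_extensive by blast
  have "f \<notin> cl (insert e F - {f})" if f: "f \<in> F" for f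
  proof
    assume "f \<in> cl (insert e F - {f})"
    moreover have "insert e F - {f} = insert e (F - {f})" using f eF by auto
    ultimately have "f \<in> cl (insert e (F - {f}))" by simp
    moreover have "f \<notin> cl (F - {f})" using assms(1) f unfolding indep_def by blast
    ultimately have "e \<in> cl (insert f (F - {f}))"
      using cl_exchange assms(2) FM by blast
    then show False using assms(3) f by (simp add: insert_absorb)
  qed
  moreover have "e \<notin> cl (insert e F - {e})" using assms(3) eF by simp
  ultimately show ?thesis using FM assms(2) unfolding indep_def by blast
qed

text \<open>In a minimal \<open>C \<subseteq> F\<close> spanning \<open>e\<close> every
  \<open>f\<close> is essential: were \<open>e\<close> spanned by \<open>F - {f}\<close>, exchange
  would put \<open>f\<close> into that closure too, against independence.\<close>

lemma fundamental_circuit: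
  assumes F: "indep F" and e: "e \<in> cl F"
  shows "e \<in> cl {f \<in> F. e \<notin> cl (F - {f})}"
proof -
  have FM: "F \<subseteq> M" using F by (simp add: indep_def)
  define \<C> where "\<C> = {C. C \<subseteq> F \<and> e \<in> cl C}"
  have "finite \<C>" "F \<in> \<C>"
    using finite_subset[OF FM finite_M] e by (auto simp: \<C>_def)
  then obtain C where "C \<in> \<C>" and min: "\<And>C'. C' \<in> \<C> \<Longrightarrow> C' \<subseteq> C \<Longrightarrow> C = C'"
    using finite_has_minimal2[of \<C> F] by blast
  then have C: "C \<subseteq> F" "e \<in> cl C" by (auto simp: \<C>_def)
  have "e \<notin> cl (F - {f})" if f: "f \<in> C" for f
  proof
    assume e': "e \<in> cl (F - {f})"
    have "C - {f} \<notin> \<C>" using min[of "C - {f}"] f by blast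
    then have "e \<notin> cl (C - {f})" using C by (auto simp: \<C>_def)
    moreover have "e \<in> cl (insert f (C - {f}))" using C f by (simp add: insert_absorb)
    ultimately have "f \<in> cl (insert e (C - {f}))"
      using cl_exchange C FM f by blast
    moreover have "cl (insert e (C - {f})) \<subseteq> cl (F - {f})"
    proof (rule cl_closed)
      have "F - {f} \<subseteq> cl (F - {f})" using FM by (intro cl_extensive) auto
      then show "insert e (C - {f}) \<subseteq> cl (F - {f})" using e' C by blast
    qed
    ultimately show False using F f C unfolding indep_def by blast
  qed
  then have "cl C \<subseteq> cl {f \<in> F. e \<notin> cl (F - {f})}"
    using C FM by (intro cl_mono) auto
  then show ?thesis using C by blast
qed

section \<open>Maximum packings and exchanges\<close>

definition packing :: "('i \<Rightarrow> 'e set) \<Rightarrow> bool" where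
  "packing F \<longleftrightarrow> (\<forall>i. indep (F i)) \<and> (\<forall>i j. i \<noteq> j \<longrightarrow> F i \<inter> F j = {})"

definition max_packing :: "('i \<Rightarrow> 'e set) \<Rightarrow> bool" where
  "max_packing F \<longleftrightarrow> packing F \<and> (\<forall>G :: 'i \<Rightarrow> 'e set. packing G \<longrightarrow> card (\<Union>i. G i) \<le> card (\<Union>i. F i))"

text \<open>One step along an augmenting path of matroid union; the premise on the closure keeps the
  changed member independent, and the covered set trades \<open>f\<close> for
  \<open>e\<close>.\<close>

inductive exchange :: "('i \<Rightarrow> 'e set) \<Rightarrow> ('i \<Rightarrow> 'e set) \<Rightarrow> bool" where
  "e \<in> M \<Longrightarrow> e \<notin> (\<Union>i. F i) \<Longrightarrow> f \<in> F i \<Longrightarrow> e \<notin> cl (F i - {f}) \<Longrightarrow>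
    exchange F (F(i := insert e (F i - {f})))"

lemma packing_subset: "packing F \<Longrightarrow> (\<Union>i. F i) \<subseteq> M"
  unfolding packing_def indep_def by blast

lemma packing_update:
  assumes "packing F" "indep X" "X \<subseteq> insert e (F i)" "e \<notin> (\<Union>i. F i)"
  shows "packing (F(i := X))"
  using assms unfolding packing_def by (auto simp: disjoint_iff)

lemma exists_max_packing: "\<exists>F :: 'i \<Rightarrow> 'e set. max_packing F"
proof -
  have "packing (\<lambda>_ :: 'i. {})" by (simp add: packing_def indep_def)
  moreover have "card (\<Union>i. F i) < Suc (card M)" if "packing F" for F :: "'i \<Rightarrow> 'e set"
    using card_mono[OF finite_M packing_subset[OF that]] by simp
  ultimately show ?thesis
    using ex_has_greatest_nat[of packing "\<lambda>_ :: 'i. {}" "\<lambda>F. card (\<Union>i. F i)" "Suc (card M)"]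
    unfolding max_packing_def by blast
qed

lemma exchange_max_packing:
  assumes "exchange F G" "max_packing F"
  shows "max_packing G"
  using assms(1)
proof cases
  case (1 e f i)
  have F: "packing F" using assms(2) by (simp add: max_packing_def)
  then have "indep (F i)" by (simp add: packing_def)
  then have "indep (insert e (F i - {f}))"
    using 1 by (intro indep_insert) (auto intro: indep_subset)
  then have G: "packing G"
    unfolding 1(1) using F 1 by (intro packing_update[where e = e]) auto
  have fin: "finite (\<Union>i. F i)" using packing_subset[OF F] finite_M finite_subset by blast
  have "f \<notin> F j" if "j \<noteq> i" for j
    using F that 1(4) unfolding packing_def by blast
  then have "(\<Union>j. G j) = insert e ((\<Union>j. F j) - {f})"
    unfolding 1(1) by (intro set_eqI) (simp, metis)
  moreover have "e \<notin> (\<Union>j. F j) - {f}" "f \<in> (\<Union>j. F j)" using 1(3,4) by auto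
  ultimately have "card (\<Union>i. G i) = card (\<Union>i. F i)"
    using card_Suc_Diff1[OF fin] fin by (simp del: UN_iff)
  then show ?thesis using G assms(2) unfolding max_packing_def by simp
qed

text \<open>The set \<open>X\<close> consists of the elements that can be made uncovered by exchanges starting
  from a maximum packing; along such exchanges the spans of the members within \<open>X\<close> only shrink.\<close>

theorem packing_closed_set:
  obtains F :: "'i \<Rightarrow> 'e set" and X where
    "packing F" "X \<subseteq> M" "M - (\<Union>i. F i) \<subseteq> X" "\<And>i. X \<subseteq> cl (F i \<inter> X)"
proof -
  obtain F0 :: "'i \<Rightarrow> 'e set" where F0: "max_packing F0" using exists_max_packing by blast
  define X where "X = (\<Union>F\<in>{F. exchange\<^sup>*\<^sup>* F0 F}. M - (\<Union>i. F i))"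
  have XM: "X \<subseteq> M" by (auto simp: X_def)
  have maxp: "max_packing F" if "exchange\<^sup>*\<^sup>* F0 F" for F
    using that by (induction rule: rtranclp_induct) (use F0 exchange_max_packing in auto)
  have covered: "e \<in> cl (F i \<inter> X)"
    if F: "exchange\<^sup>*\<^sup>* F0 F" and e: "e \<in> M" "e \<notin> (\<Union>i. F i)" for F e i
  proof -
    have p: "packing F" and max: "\<And>G :: 'i \<Rightarrow> 'e set. packing G \<Longrightarrow> card (\<Union>i. G i) \<le> card (\<Union>i. F i)"
      using maxp[OF F] unfolding max_packing_def by blast+
    have ind: "indep (F i)" using p by (simp add: packing_def)
    have "e \<in> cl (F i)"
    proof (rule ccontr)
      \<comment> \<open>Otherwise adding \<open>e\<close> to \<open>F i\<close> would give a larger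
        packing.\<close>
      assume "e \<notin> cl (F i)"
      then have "packing (F(i := insert e (F i)))"
        using p ind e by (intro packing_update[where e = e] indep_insert) auto
      then have "card (\<Union>j. (F(i := insert e (F i))) j) \<le> card (\<Union>j. F j)" by (rule max)
      moreover have "(\<Union>j. (F(i := insert e (F i))) j) = insert e (\<Union>j. F j)"
        by (auto split: if_splits)
      moreover have "finite (\<Union>j. F j)" using packing_subset[OF p] finite_M finite_subset by blast
      ultimately show False using e(2) by simp
    qed
    then have "e \<in> cl {f \<in> F i. e \<notin> cl (F i - {f})}" by (rule fundamental_circuit[OF ind])
    \<comment> \<open>Each element of the fundamental circuit can be exchanged for \<open>e\<close>
      and is then itself uncovered.\<close>
    moreover have "{f \<in> F i. e \<notin> cl (F i - {f})} \<subseteq> F i \<inter> X"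
    proof
      fix f assume "f \<in> {f \<in> F i. e \<notin> cl (F i - {f})}"
      then have f: "f \<in> F i" "e \<notin> cl (F i - {f})" by auto
      let ?G = "F(i := insert e (F i - {f}))"
      have "exchange F ?G" using e f by (intro exchange.intros)
      with F have "exchange\<^sup>*\<^sup>* F0 ?G" by simp
      moreover have "f \<in> M" using f(1) packing_subset[OF p] by blast
      moreover have "f \<notin> F j" if "j \<noteq> i" for j
        using p that f(1) unfolding packing_def by blast
      then have "f \<notin> (\<Union>j. ?G j)" using f(1) e(2) by (auto split: if_splits)
      ultimately have "f \<in> X" unfolding X_def by blast
      then show "f \<in> F i \<inter> X" using f(1) by blast
    qed
    then have "cl {f \<in> F i. e \<notin> cl (F i - {f})} \<subseteq> cl (F i \<inter> X)"
      using XM by (intro cl_mono) auto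
    ultimately show ?thesis by blast
  qed
  have shrink: "cl (F j \<inter> X) \<subseteq> cl (F0 j \<inter> X)" if "exchange\<^sup>*\<^sup>* F0 F" for F j
    using that
  proof (induction rule: rtranclp_induct)
    case (step F G)
    from step.hyps(2) have "cl (G j \<inter> X) \<subseteq> cl (F j \<inter> X)"
    proof cases
      case (1 e f i)
      \<comment> \<open>The exchange adds only \<open>e\<close>, which \<open>covered\<close>
        already places in the closure of the old member within \<open>X\<close>.\<close>
      have "F j \<inter> X \<subseteq> cl (F j \<inter> X)" using XM by (intro cl_extensive) auto
      moreover have "e \<in> cl (F j \<inter> X)" using covered[OF step.hyps(1)] 1 by blast
      ultimately show ?thesis unfolding 1(1) by (intro cl_closed) (auto split: if_splits)
    qed
    then show ?case using step.IH by blast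
  qed simp
  show ?thesis
  proof (rule that[OF _ XM])
    show "packing F0" using F0 by (simp add: max_packing_def)
    show "M - (\<Union>i. F0 i) \<subseteq> X" unfolding X_def by blast
    fix i show "X \<subseteq> cl (F0 i \<inter> X)"
    proof
      fix e assume "e \<in> X"
      then obtain F where F: "exchange\<^sup>*\<^sup>* F0 F" "e \<in> M" "e \<notin> (\<Union>i. F i)" unfolding X_def by blast
      show "e \<in> cl (F0 i \<inter> X)" by (rule subsetD[OF shrink[OF F(1)] covered[OF F]])
    qed
  qed
qed

end

section \<open>Disjoint connecting sets\<close>

text \<open>A walk can be shortened to use \<open>f\<close> at most once, in one of its two
  directions.\<close>

lemma adj_insert_rtrancl:
  assumes "(x, y) \<in> (adj ends (insert f F))\<^sup>*" "ends f = {u, v}"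
  shows "(x, y) \<in> (adj ends F)\<^sup>* \<or>
    (x, u) \<in> (adj ends F)\<^sup>* \<and> (v, y) \<in> (adj ends F)\<^sup>* \<or>
    (x, v) \<in> (adj ends F)\<^sup>* \<and> (u, y) \<in> (adj ends F)\<^sup>*"
  using assms(1)
proof (induction rule: rtrancl_induct)
  case base
  then show ?case by simp
next
  case (step y z)
  then obtain e where e: "e \<in> insert f F" "ends e = {y, z}" by blast
  show ?case
  proof (cases "e = f")
    case True
    then have "y = u \<and> z = v \<or> y = v \<and> z = u"
      using e(2) assms(2) by (auto simp: doubleton_eq_iff)
    then show ?thesis using step.IH by (elim disjE conjE) (simp_all only: rtrancl.rtrancl_refl simp_thms)
  next
    case False
    then have "(y, z) \<in> adj ends F" using e by blast
    then have "(a, z) \<in> (adj ends F)\<^sup>*" if "(a, y) \<in> (adj ends F)\<^sup>*" for a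
      using that by (rule rtrancl_into_rtrancl[rotated])
    then show ?thesis using step.IH by blast
  qed
qed

context multigraph
begin

text \<open>The closure operator of the graphic matroid of \<open>G\<close> with \<open>D\<close>
  contracted. Quantifying over both orders of the ends avoids orienting \<open>e\<close>.\<close>

definition span :: "'e set \<Rightarrow> 'e set \<Rightarrow> 'e set" where
  "span D F = {e \<in> E - D. \<forall>x y. ends e = {x, y} \<longrightarrow> (x, y) \<in> (adj ends (D \<union> F))\<^sup>*}"

lemma ends_obtain:
  assumes "e \<in> E"
  obtains x y where "ends e = {x, y}" "x \<noteq> y" "x \<in> V" "y \<in> V"
  using card_ends[OF assms] ends_subset[OF assms] unfolding card_2_iff by blast

lemma spanI:
  assumes "e \<in> E - D" "ends e = {x, y}" "(x, y) \<in> (adj ends (D \<union> F))\<^sup>*"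
  shows "e \<in> span D F"
proof -
  have "(y, x) \<in> (adj ends (D \<union> F))\<^sup>*" using assms(3) by (rule adj_rtrancl_sym)
  then show ?thesis using assms unfolding span_def by (auto simp: doubleton_eq_iff)
qed

lemma adj_span_subset:
  assumes "F \<subseteq> span D G"
  shows "(adj ends (D \<union> F))\<^sup>* \<subseteq> (adj ends (D \<union> G))\<^sup>*"
proof -
  have "(x, y) \<in> (adj ends (D \<union> G))\<^sup>*" if "e \<in> D \<union> F" "ends e = {x, y}" for e x y
  proof (cases "e \<in> D")
    case True
    then have "(x, y) \<in> adj ends (D \<union> G)" using that by blast
    then show ?thesis ..
  next
    case False
    then show ?thesis using that assms unfolding span_def by blast
  qed
  then have "adj ends (D \<union> F) \<subseteq> (adj ends (D \<union> G))\<^sup>*" by blast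
  then show ?thesis by (rule rtrancl_subset_rtrancl)
qed

text \<open>For exchange: a path joining the ends of \<open>e\<close> must use \<open>f\<close>, so
  without \<open>f\<close> it falls into two pieces, which \<open>e\<close> links to a path joining
  the ends of \<open>f\<close>.\<close>

lemma matroid_closure_span: "matroid_closure (E - D) (span D)"
proof
  show "finite (E - D)" using finite_E by simp
  show "span D F \<subseteq> E - D" for F by (auto simp: span_def)
  show "F \<subseteq> span D F" if "F \<subseteq> E - D" for F
  proof
    fix e assume e: "e \<in> F"
    then have "e \<in> E" using that by blast
    then obtain x y where xy: "ends e = {x, y}" by (rule ends_obtain)
    then have "(x, y) \<in> adj ends (D \<union> F)" using e by blast
    then show "e \<in> span D F" using spanI[OF _ xy] e that by blast
  qed
  show "span D F \<subseteq> span D G" if "F \<subseteq> span D G" for F G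
    using adj_span_subset[OF that] unfolding span_def by blast
  show "f \<in> span D (insert e F)"
    if ef: "e \<in> span D (insert f F)" "f \<in> E - D" "F \<subseteq> E - D" "e \<notin> span D F" for e f F
  proof -
    have eE: "e \<in> E - D" using ef(1) by (simp add: span_def)
    obtain x y where xy: "ends e = {x, y}" using ends_obtain[of e] eE by blast
    obtain u v where uv: "ends f = {u, v}" using ends_obtain[of f] ef(2) by blast
    let ?R = "(adj ends (D \<union> F))\<^sup>*" and ?S = "(adj ends (D \<union> insert e F))\<^sup>*"
    have "(x, y) \<notin> ?R" using ef(4) spanI[OF eE xy] by blast
    moreover have "(x, y) \<in> (adj ends (insert f (D \<union> F)))\<^sup>*"
      using ef(1) xy unfolding span_def by simp
    ultimately have "(x, u) \<in> ?R \<and> (v, y) \<in> ?R \<or> (x, v) \<in> ?R \<and> (u, y) \<in> ?R"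
      using adj_insert_rtrancl[where F = "D \<union> F" and ends = ends and f = f and x = x and y = y, OF _ uv]
      by blast
    moreover have RS: "?R \<subseteq> ?S" by (rule adj_rtrancl_mono) auto
    ultimately have c: "(x, u) \<in> ?S \<and> (v, y) \<in> ?S \<or> (x, v) \<in> ?S \<and> (u, y) \<in> ?S" by blast
    have "(x, y) \<in> adj ends (D \<union> insert e F)" using xy by blast
    then have xyS: "(x, y) \<in> ?S" ..
    from c have "(u, v) \<in> ?S"
    proof
      assume a: "(x, u) \<in> ?S \<and> (v, y) \<in> ?S"
      have "(u, x) \<in> ?S" by (rule adj_rtrancl_sym) (rule a[THEN conjunct1])
      moreover have "(y, v) \<in> ?S" by (rule adj_rtrancl_sym) (rule a[THEN conjunct2])
      ultimately show ?thesis using xyS by (blast intro: rtrancl_trans[of u x] rtrancl_trans[of x y])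
    next
      assume a: "(x, v) \<in> ?S \<and> (u, y) \<in> ?S"
      have "(y, x) \<in> ?S" by (rule adj_rtrancl_sym) (rule xyS)
      then show ?thesis using a by (blast intro: rtrancl_trans[of u y] rtrancl_trans[of y x])
    qed
    then show ?thesis by (rule spanI[OF ef(2) uv])
  qed
qed

text \<open>The old classes map onto the new ones, and the map is not injective because the classes
  of the two ends of \<open>e\<close> merge.\<close>

lemma card_classes_insert:
  assumes "e \<in> E - D" "e \<notin> span D F"
  shows "card (reach ends (D \<union> insert e F) ` V) < card (reach ends (D \<union> F) ` V)"
proof -
  let ?r = "reach ends (D \<union> F)" and ?r' = "reach ends (D \<union> insert e F)"
  have "e \<in> E" using assms(1) by blast
  then obtain x y where xy: "ends e = {x, y}" "x \<noteq> y" "x \<in> V" "y \<in> V" by (rule ends_obtain)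
  have sub: "?r v \<subseteq> ?r' v" for v
    unfolding reach_def by (intro Image_mono adj_rtrancl_mono) auto
  have union: "\<Union> (?r' ` ?r v) = ?r' v" for v
  proof -
    have "?r' u = ?r' v" if "u \<in> ?r v" for u
      using reach_eq[OF subsetD[OF sub that]] .
    then have "\<Union> (?r' ` ?r v) = (\<Union>u\<in>?r v. ?r' v)" by (rule SUP_cong[OF refl])
    moreover have "?r v \<noteq> {}" using reach_refl[of v ends "D \<union> F"] by blast
    ultimately show ?thesis by simp
  qed
  let ?g = "\<lambda>C. \<Union> (?r' ` C)"
  have im: "?r' ` V = ?g ` ?r ` V" by (simp only: image_image union)
  have fin: "finite (?r ` V)" using finite_V by simp
  have "\<not> inj_on ?g (?r ` V)"
  proof
    assume inj: "inj_on ?g (?r ` V)"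
    have "y \<in> ?r' x" by (rule reach_step[where v = x and e = e]) (simp_all add: xy(1))
    then have "?g (?r y) = ?g (?r x)" unfolding union by (rule reach_eq)
    then have "?r y = ?r x" by (rule inj_onD[OF inj _ imageI[OF xy(4)] imageI[OF xy(3)]])
    then have "y \<in> ?r x" using reach_refl[of y ends "D \<union> F"] by simp
    then show False using assms(2) spanI[OF assms(1) xy(1)] unfolding reach_iff by blast
  qed
  then have "card (?g ` ?r ` V) \<noteq> card (?r ` V)" using eq_card_imp_inj_on[OF fin] by blast
  then show ?thesis unfolding im using card_image_le[OF fin, of ?g] by simp
qed

text \<open>Add the edges of \<open>F - A\<close> one by one; by independence none is spanned by
  those before it, so each lowers the number of classes.\<close>

lemma card_classes_indep:
  assumes "matroid_closure.indep (E - D) (span D) F" "A \<subseteq> F"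
  shows "card (reach ends (D \<union> F) ` V) + card (F - A) \<le> card (reach ends (D \<union> A) ` V)"
proof -
  interpret matroid_closure "E - D" "span D" by (rule matroid_closure_span)
  have FE: "F \<subseteq> E - D" using assms(1) by (simp add: indep_def)
  have "finite (F - A)" using finite_subset[OF FE finite_M] by simp
  moreover have "card (reach ends (D \<union> (A \<union> B)) ` V) + card B \<le> card (reach ends (D \<union> A) ` V)"
    if "finite B" "B \<subseteq> F - A" for B
    using that
  proof (induction B rule: finite_induct)
    case (insert e B)
    have "indep (insert e (A \<union> B))" using insert.prems assms by (intro indep_subset[OF assms(1)]) auto
    moreover have "insert e (A \<union> B) - {e} = A \<union> B" using insert by auto
    ultimately have "e \<notin> span D (A \<union> B)" unfolding indep_def by (metis insertI1)
    moreover have "e \<in> E - D" using insert.prems FE by blast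
    ultimately have "card (reach ends (D \<union> insert e (A \<union> B)) ` V) < card (reach ends (D \<union> (A \<union> B)) ` V)"
      by (intro card_classes_insert)
    then show ?case using insert by simp
  qed simp
  ultimately have "card (reach ends (D \<union> (A \<union> (F - A))) ` V) + card (F - A) \<le> card (reach ends (D \<union> A) ` V)"
    by blast
  moreover have "A \<union> (F - A) = F" using assms(2) by blast
  ultimately show ?thesis by simp
qed

lemma class_cut_disjoint:
  assumes "K \<subseteq> E" "v \<in> V"
  shows "edge_cut E ends (reach ends K v) \<inter> K = {}"
proof (rule ccontr)
  assume "edge_cut E ends (reach ends K v) \<inter> K \<noteq> {}"
  then obtain e where e: "e \<in> edge_cut E ends (reach ends K v)" "e \<in> K" by blast
  obtain x y where "e \<in> E" "ends e = {x, y}" "x \<in> reach ends K v" "y \<in> V" "y \<notin> reach ends K v"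
    using e(1) order_refl reach_subset[OF assms] by (rule edge_cutE)
  then show False using reach_step e(2) by metis
qed

text \<open>Handshake count: an edge lies only in the cuts of the classes of its two ends.\<close>

lemma sum_class_cuts_le:
  assumes K: "K \<subseteq> E"
  defines "\<C> \<equiv> reach ends K ` V"
  shows "(\<Sum>U\<in>\<C>. card (edge_cut E ends U)) \<le> 2 * card (\<Union>U\<in>\<C>. edge_cut E ends U)"
proof -
  let ?X = "\<Union>U\<in>\<C>. edge_cut E ends U"
  have fin\<C>: "finite \<C>" unfolding \<C>_def using finite_V by simp
  have XE: "?X \<subseteq> E" unfolding edge_cut_def by blast
  have finX: "finite ?X" using XE finite_E finite_subset by blast
  have "card {U \<in> \<C>. e \<in> edge_cut E ends U} \<le> 2" if e: "e \<in> E" for e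
  proof -
    obtain x y where xy: "ends e = {x, y}" using e by (rule ends_obtain)
    have "{U \<in> \<C>. e \<in> edge_cut E ends U} \<subseteq> {reach ends K x, reach ends K y}"
    proof
      fix U assume "U \<in> {U \<in> \<C>. e \<in> edge_cut E ends U}"
      then have "U \<in> reach ends K ` V" and eU: "e \<in> edge_cut E ends U"
        unfolding \<C>_def by simp_all
      then obtain v where v: "U = reach ends K v" "v \<in> V" by (auto elim: imageE)
      obtain a b where "e \<in> E" "ends e = {a, b}" "a \<in> U" "b \<in> V" "b \<notin> U"
        using eU order_refl reach_subset[OF K v(2)] unfolding v(1) by (rule edge_cutE)
      then have "reach ends K a = U" "a \<in> {x, y}"
        unfolding v(1) using xy reach_eq[of a ends K v] by simp_all
      then show "U \<in> {reach ends K x, reach ends K y}" by blast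
    qed
    then have "card {U \<in> \<C>. e \<in> edge_cut E ends U} \<le> card {reach ends K x, reach ends K y}"
      by (intro card_mono) auto
    also have "\<dots> \<le> 2" by (simp add: card_insert_if)
    finally show ?thesis .
  qed
  then have "(\<Sum>e\<in>?X. card {U \<in> \<C>. e \<in> edge_cut E ends U}) \<le> (\<Sum>e\<in>?X. 2)"
    using XE by (intro sum_mono) blast
  moreover have "(\<Sum>e\<in>?X. card {U \<in> \<C>. e \<in> edge_cut E ends U}) = (\<Sum>U\<in>\<C>. card (edge_cut E ends U))"
  proof (rule sum_multicount_gen[OF finX fin\<C>], rule ballI)
    fix U assume "U \<in> \<C>"
    then have "{e \<in> ?X. e \<in> edge_cut E ends U} = edge_cut E ends U" by blast
    then show "card {e \<in> ?X. e \<in> edge_cut E ends U} = card (edge_cut E ends U)" by simp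
  qed
  ultimately show ?thesis by simp
qed

text \<open>Take two disjoint forests of \<open>G / D\<close> and the set \<open>X\<close> from
  \<open>packing_closed_set\<close>. If \<open>D \<union> X\<close> had \<open>k > 1\<close>
  classes, at least \<open>2 * k\<close> edges would run between classes, all of them in the forests
  outside \<open>X\<close>, yet each forest has at most \<open>k - 1\<close> edges outside
  \<open>X\<close>.\<close>

theorem two_disjoint_connecting_sets:
  assumes D: "D \<subseteq> E"
    and cuts: "\<And>U. U \<noteq> {} \<Longrightarrow> U \<subset> V \<Longrightarrow> edge_cut E ends U \<inter> D = {} \<Longrightarrow> 4 \<le> card (edge_cut E ends U)"
  obtains F1 F2 where "F1 \<subseteq> E - D" "F2 \<subseteq> E - D" "F1 \<inter> F2 = {}"
    "connected_by V ends (D \<union> F1)" "connected_by V ends (D \<union> F2)"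
proof -
  interpret matroid_closure "E - D" "span D" by (rule matroid_closure_span)
  obtain F :: "bool \<Rightarrow> 'e set" and X where F: "packing F" and X: "X \<subseteq> E - D"
    and cov: "E - D - (\<Union>i. F i) \<subseteq> X" and spans: "\<And>i. X \<subseteq> span D (F i \<inter> X)"
    by (rule packing_closed_set) blast
  have ind: "indep (F i)" and FE: "F i \<subseteq> E - D" for i
    using F unfolding packing_def indep_def by blast+
  have finF: "finite (F i)" for i using FE finite_M finite_subset by blast
  let ?K = "D \<union> X"
  define \<C> where "\<C> = reach ends ?K ` V"
  have KE: "?K \<subseteq> E" using D X by blast
  have fin\<C>: "finite \<C>" unfolding \<C>_def using finite_V by simp
  \<comment> \<open>The edges of each forest within \<open>X\<close> already connect whatever
    \<open>X\<close> connects.\<close>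
  have R_sub: "(adj ends ?K)\<^sup>* \<subseteq> (adj ends (D \<union> F i))\<^sup>*" for i
  proof -
    have "(adj ends ?K)\<^sup>* \<subseteq> (adj ends (D \<union> (F i \<inter> X)))\<^sup>*" by (rule adj_span_subset[OF spans])
    also have "\<dots> \<subseteq> (adj ends (D \<union> F i))\<^sup>*" by (rule adj_rtrancl_mono) blast
    finally show ?thesis .
  qed
  have one: "card \<C> \<le> 1"
  proof (rule ccontr)
    assume "\<not> card \<C> \<le> 1"
    then have two: "2 \<le> card \<C>" by simp
    then have "V \<noteq> {}" unfolding \<C>_def by (cases "V = {}") simp_all
    then obtain v0 where v0: "v0 \<in> V" by blast
    have part: "card (F i - X) + 1 \<le> card \<C>" for i
    proof -
      have "reach ends (D \<union> (F i \<inter> X)) = reach ends ?K"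
      proof -
        have "(adj ends (D \<union> (F i \<inter> X)))\<^sup>* = (adj ends ?K)\<^sup>*"
          using adj_span_subset[OF spans, of i] adj_rtrancl_mono[of "D \<union> (F i \<inter> X)" ?K ends] by blast
        then show ?thesis unfolding reach_def by simp
      qed
      moreover have "0 < card (reach ends (D \<union> F i) ` V)"
        using v0 finite_V by (auto simp: card_gt_0_iff)
      moreover have "F i - F i \<inter> X = F i - X" by blast
      ultimately show ?thesis
        using card_classes_indep[OF ind, of "F i \<inter> X" i] unfolding \<C>_def by simp
    qed
    have four: "4 \<le> card (edge_cut E ends U)" if U: "U \<in> \<C>" for U
    proof -
      obtain v where v: "U = reach ends ?K v" "v \<in> V" using U unfolding \<C>_def by (rule imageE)
      have "U \<subseteq> V" unfolding v(1) by (rule reach_subset[OF KE v(2)])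
      moreover have "U \<noteq> V"
      proof
        assume "U = V"
        then have "reach ends ?K x = U" if "x \<in> V" for x
          using reach_eq[of x ends ?K v] that v(1) by simp
        then have "\<C> \<subseteq> {U}" unfolding \<C>_def by (intro image_subsetI) simp
        then show False using two card_mono[of "{U}" \<C>] by simp
      qed
      moreover have "U \<noteq> {}" using v(1) reach_refl[of v ends ?K] by blast
      moreover have "edge_cut E ends U \<inter> D = {}" using class_cut_disjoint[OF KE v(2)] v(1) by blast
      ultimately show ?thesis using cuts by blast
    qed
    let ?C = "\<Union>U\<in>\<C>. edge_cut E ends U"
    \<comment> \<open>No edge of \<open>D\<close> or \<open>X\<close> runs between classes, so every
      crossing edge is covered by the packing.\<close>
    have "?C \<subseteq> E - ?K"
      using class_cut_disjoint[OF KE] unfolding \<C>_def edge_cut_def by blast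
    then have "?C \<subseteq> (F True - X) \<union> (F False - X)" using cov by (auto simp: UNIV_bool)
    then have "card ?C \<le> card ((F True - X) \<union> (F False - X))"
      using finF by (intro card_mono) auto
    also have "\<dots> \<le> card (F True - X) + card (F False - X)" by (rule card_Un_le)
    finally have "card ?C + 2 \<le> 2 * card \<C>" using part[of True] part[of False] by simp
    moreover have "(\<Sum>U\<in>\<C>. card (edge_cut E ends U)) \<le> 2 * card ?C"
      unfolding \<C>_def by (rule sum_class_cuts_le[OF KE])
    moreover have "4 * card \<C> \<le> (\<Sum>U\<in>\<C>. card (edge_cut E ends U))"
      using sum_mono[of \<C> "\<lambda>_. 4" "\<lambda>U. card (edge_cut E ends U)"] four by simp
    ultimately show False by simp
  qed
  have conn: "connected_by V ends (D \<union> F i)" for i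
    unfolding connected_by_def
  proof (intro ballI)
    fix u v assume uv: "u \<in> V" "v \<in> V"
    have "\<forall>A\<in>\<C>. \<forall>B\<in>\<C>. A = B" using one card_le_Suc0_iff_eq[OF fin\<C>] by simp
    then have "reach ends ?K u = reach ends ?K v" using uv unfolding \<C>_def by blast
    then have "v \<in> reach ends ?K u" using reach_refl[of v ends ?K] by simp
    then have "(u, v) \<in> (adj ends ?K)\<^sup>*" unfolding reach_iff .
    then show "(u, v) \<in> (adj ends (D \<union> F i))\<^sup>*" using R_sub by blast
  qed
  show ?thesis
  proof (rule that[OF FE FE _ conn conn])
    show "F True \<inter> F False = {}" using F unfolding packing_def by blast
  qed
qed

end

section \<open>Tours\<close>

context multigraph
begin

lemma connected_cut_nonempty:
  assumes conn: "connected_by V ends E" and U: "U \<noteq> {}" "U \<subset> V"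
  shows "0 < card (edge_cut E ends U)"
proof -
  obtain u v where uv: "u \<in> U" "v \<in> V" "v \<notin> U" using U by blast
  have "edge_cut E ends U \<noteq> {}"
  proof
    assume empty: "edge_cut E ends U = {}"
    have "(u, v) \<in> (adj ends E)\<^sup>*"
      using conn uv U unfolding connected_by_def by blast
    then have "v \<in> U"
    proof (induction rule: rtrancl_induct)
      case (step y z)
      then obtain e where e: "e \<in> E" "ends e = {y, z}" by blast
      show ?case
      proof (rule ccontr)
        assume "z \<notin> U"
        then have "e \<in> edge_cut E ends U"
          using edge_cutI[OF e(1) order_refl _ e(2) step.IH] U by blast
        then show False using empty by blast
      qed
    qed (rule uv(1))
    then show False using uv by blast
  qed
  moreover have "finite (edge_cut E ends U)" using finite_E by (simp add: edge_cut_def)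
  ultimately show ?thesis by (simp add: card_gt_0_iff)
qed

text \<open>Adding one edge between \<open>s\<close> and \<open>t\<close> (if they differ) turns every odd cut into a cut of at
  least three edges: a cut separating \<open>s\<close> from \<open>t\<close> is nonempty and gains one edge.\<close>

lemma even_set_avoiding_small_cuts:
  assumes conn: "connected_by V ends E" and st: "s \<in> V" "t \<in> V"
    and cuts: "\<And>U. U \<noteq> {} \<Longrightarrow> U \<subset> V \<Longrightarrow> card (U \<inter> {s, t}) \<noteq> 1 \<Longrightarrow> 3 \<le> card (edge_cut E ends U)"
  obtains D where "D \<subseteq> E" "odd_set D = sym_diff {s} {t}"
    "\<forall>U. U \<noteq> {} \<longrightarrow> U \<subset> V \<longrightarrow> edge_cut E ends U \<inter> D = {} \<longrightarrow> 4 \<le> card (edge_cut E ends U)"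
proof -
  \<comment> \<open>\<open>None\<close> is the added edge between \<open>s\<close> and
    \<open>t\<close>; it is omitted for \<open>s = t\<close>, where it would be a loop.\<close>
  define E' where "E' = Some ` E \<union> (if s = t then {} else {None})"
  define ends' where "ends' = case_option {s, t} ends"
  have ends'_simps [simp]: "ends' None = {s, t}" "ends' (Some e) = ends e" for e
    by (simp_all add: ends'_def)
  interpret G: multigraph V E' ends'
  proof
    show "finite V" "finite E'" using finite_V finite_E by (simp_all add: E'_def)
    show "ends' e \<subseteq> V" "card (ends' e) = 2" if "e \<in> E'" for e
      using that ends_subset[of "the e"] card_ends[of "the e"] st unfolding E'_def
      by (cases e; auto split: if_splits)+
  qed
  have cut': "edge_cut E' ends' U
      = Some ` edge_cut E ends U \<union> (if s \<noteq> t \<and> card (U \<inter> {s, t}) = 1 then {None} else {})" for U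
    unfolding edge_cut_def E'_def by (auto simp: Int_commute)
  have card_cut': "card (edge_cut E' ends' U)
      = card (edge_cut E ends U) + (if s \<noteq> t \<and> card (U \<inter> {s, t}) = 1 then 1 else 0)" for U
  proof -
    have "finite (edge_cut E ends U)" using finite_E by (simp add: edge_cut_def)
    then show ?thesis unfolding cut' by (auto simp: card_image)
  qed
  have big: "3 \<le> card (edge_cut E ends U)"
    if U: "U \<noteq> {}" "U \<subset> V" "s = t \<or> card (U \<inter> {s, t}) \<noteq> 1" for U
  proof (cases "card (U \<inter> {s, t}) = 1")
    case False
    then show ?thesis using cuts U by blast
  next
    case True
    \<comment> \<open>For \<open>s = t\<close> in \<open>U\<close> the hypothesis says nothing about
      \<open>U\<close>, but it applies to the complement, which has the same cut.\<close>
    then have "s = t" "s \<in> U" using U(3) by (auto simp: Int_insert_right split: if_splits)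
    then have "3 \<le> card (edge_cut E ends (V - U))" using U by (intro cuts) auto
    moreover have "card (ends e \<inter> (V - U)) = 1 \<longleftrightarrow> card (ends e \<inter> U) = 1" if e: "e \<in> E" for e
    proof -
      obtain x y where "ends e = {x, y}" "x \<noteq> y" "x \<in> V" "y \<in> V" using e by (rule ends_obtain)
      then show ?thesis by (cases "x \<in> U"; cases "y \<in> U") simp_all
    qed
    then have "edge_cut E ends (V - U) = edge_cut E ends U" unfolding edge_cut_def by blast
    ultimately show ?thesis by simp
  qed
  have odd_cuts: "3 \<le> card (edge_cut E' ends' U)" if U: "U \<subseteq> V" "odd (card (edge_cut E' ends' U))" for U
  proof -
    have "edge_cut E' ends' U = {}" if "U = {} \<or> U = V"
    proof -
      have "card (ends' e \<inter> U) \<noteq> 1" if "e \<in> E'" for e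
        using \<open>U = {} \<or> U = V\<close> G.ends_subset[OF that] G.card_ends[OF that] by (auto simp: Int_absorb2)
      then show ?thesis unfolding edge_cut_def by blast
    qed
    then have U': "U \<noteq> {}" "U \<subset> V" using U by auto
    show ?thesis
    proof (cases "s = t \<or> card (U \<inter> {s, t}) \<noteq> 1")
      case True
      then show ?thesis using big[OF U' True] unfolding card_cut' by simp
    next
      case False
      \<comment> \<open>The original cut is nonempty by connectivity, so the new one has at least 2
        edges and, being odd, at least 3.\<close>
      then have "card (edge_cut E' ends' U) = card (edge_cut E ends U) + 1" unfolding card_cut' by simp
      moreover obtain k where "card (edge_cut E' ends' U) = 2 * k + 1" using U(2) by (rule oddE)
      moreover from calculation have "k \<noteq> 0" using connected_cut_nonempty[OF conn U'] by auto
      ultimately show ?thesis by simp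
    qed
  qed
  obtain D' where D': "D' \<subseteq> E'" "G.odd_set D' = {}" "None \<in> E' \<longrightarrow> None \<in> D'"
    "\<forall>U\<subseteq>V. card (edge_cut E' ends' U) = 3 \<longrightarrow> D' \<inter> edge_cut E' ends' U \<noteq> {}"
    using odd_cuts by (rule G.even_set_three_cuts)
  define D where "D = {e. Some e \<in> D'}"
  have DE: "D \<subseteq> E" using D'(1) unfolding D_def E'_def by (auto split: if_splits)
  have D'_eq: "D' = Some ` D \<union> (if s = t then {} else {None})"
  proof (rule set_eqI)
    fix a show "a \<in> D' \<longleftrightarrow> a \<in> Some ` D \<union> (if s = t then {} else {None})"
      using D'(1,3) unfolding D_def E'_def by (cases a) (auto split: if_splits)
  qed
  show ?thesis
  proof (rule that[OF DE], goal_cases)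
    case 1
    \<comment> \<open>Dropping \<open>None\<close> from the even set \<open>D'\<close> flips the
      parity exactly at \<open>s\<close> and \<open>t\<close>.\<close>
    have odd_D: "odd (card {e \<in> D. v \<in> ends e}) \<longleftrightarrow> v \<in> sym_diff {s} {t}" if v: "v \<in> V" for v
    proof -
      define A where "A = {e \<in> D. v \<in> ends e}"
      define q where "q \<longleftrightarrow> v \<in> sym_diff {s} {t}"
      have "{e \<in> D'. v \<in> ends' e} = Some ` A \<union> (if q then {None} else {})"
        unfolding D'_eq A_def q_def by auto
      moreover have "finite A" unfolding A_def using finite_edges[OF DE] by simp
      ultimately have "card {e \<in> D'. v \<in> ends' e} = card A + (if q then 1 else 0)"
        by (cases q) (simp_all add: card_image)
      moreover have "v \<notin> G.odd_set D'" using D'(2) by simp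
      then have "even (card {e \<in> D'. v \<in> ends' e})" using v by (simp add: G.odd_set_def)
      ultimately have "odd (card A) \<longleftrightarrow> q" by (cases q) simp_all
      then show ?thesis unfolding A_def q_def .
    qed
    show ?case
    proof (rule set_eqI)
      fix v show "v \<in> odd_set D \<longleftrightarrow> v \<in> sym_diff {s} {t}"
      proof (cases "v \<in> V")
        case True
        then show ?thesis using odd_D[OF True] by (simp add: odd_set_def)
      next
        case False
        then have "v \<noteq> s" "v \<noteq> t" using st by blast+
        then show ?thesis using False by (simp add: odd_set_def)
      qed
    qed
  next
    case 2
    have "4 \<le> card (edge_cut E ends U)"
      if U: "U \<noteq> {}" "U \<subset> V" and empty: "edge_cut E ends U \<inter> D = {}" for U
    proof -
      have UV: "U \<subseteq> V" using U by blast
      \<comment> \<open>\<open>D'\<close> has an even number of edges in the cut and could only have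
        \<open>None\<close> there, so it has none. Hence the cut does not separate \<open>s\<close>
        from \<open>t\<close> and is not a 3-cut, which leaves at least 4 edges.\<close>
      have sub: "D' \<inter> edge_cut E' ends' U \<subseteq> {None}"
        using empty unfolding cut' D'_eq by auto
      have "even (card (edge_cut D' ends' U))"
        using G.odd_cut_iff[OF D'(1) UV] D'(2) by simp
      then have "even (card (D' \<inter> edge_cut E' ends' U))"
        unfolding G.edge_cut_Int[OF D'(1)] .
      then have "D' \<inter> edge_cut E' ends' U \<noteq> {None}" using odd_one by (metis card_1_singleton_iff One_nat_def)
      then have none: "D' \<inter> edge_cut E' ends' U = {}" using sub by blast
      have st_even: "s = t \<or> card (U \<inter> {s, t}) \<noteq> 1"
      proof (rule ccontr)
        assume "\<not> ?thesis"
        then have "None \<in> edge_cut E' ends' U" "None \<in> D'" unfolding cut' D'_eq by simp_all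
        then show False using none by blast
      qed
      then have "card (edge_cut E' ends' U) = card (edge_cut E ends U)" unfolding card_cut' by auto
      moreover have "card (edge_cut E' ends' U) \<noteq> 3" using D'(4) UV none by blast
      ultimately show ?thesis using big[OF U st_even] by simp
    qed
    then show ?case by blast
  qed
qed

text \<open>Doubled edges supply connectivity and leave all parities unchanged.\<close>

lemma st_tour_double:
  assumes D: "D \<subseteq> E" "odd_set D = sym_diff {s} {t}" and F: "F \<subseteq> E"
    and conn: "connected_by V ends (D \<union> F)"
  shows "st_tour V E ends s t (mset_set D + (mset_set F + mset_set F))"
proof -
  have fin: "finite D" "finite F" using D F finite_edges by blast+
  have "odd (vertex_degree ends (mset_set D + (mset_set F + mset_set F)) v) \<longleftrightarrow>
      odd (card {e \<in> D. v \<in> ends e})" for v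
    unfolding vertex_degree_def using fin by simp
  then have "{v \<in> V. odd (vertex_degree ends (mset_set D + (mset_set F + mset_set F)) v)} = odd_set D"
    unfolding odd_set_def by simp
  then show ?thesis unfolding st_tour_def using D F conn fin by simp
qed

lemma incidence_vector_double:
  assumes "D \<subseteq> E" "F \<subseteq> E"
  shows "incidence_vector (mset_set D + (mset_set F + mset_set F)) e
    = (if e \<in> D then 1 else 0) + (if e \<in> F then 2 else 0)"
proof -
  have "finite D" "finite F" using assms finite_edges by blast+
  then show ?thesis by (simp add: incidence_vector_def count_mset_set')
qed

end

lemma convex_combination_of_midpoint:
  assumes "y \<in> X" "z \<in> X" "\<And>e. e \<in> E \<Longrightarrow> x e = (y e + z e) / 2"
  shows "convex_combination_of E x X"
\<comment> \<open>For \<open>y = z\<close> the set \<open>{y, z}\<close> has one element and weight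
  1/2 on it would not sum to 1.\<close>
proof (cases "y = z")
  case True
  then show ?thesis unfolding convex_combination_of_def
    using assms by (intro exI[of _ "{y}"] exI[of _ "\<lambda>_. 1"]) auto
next
  case False
  then show ?thesis unfolding convex_combination_of_def
    using assms by (intro exI[of _ "{y, z}"] exI[of _ "\<lambda>_. 1 / 2"]) (auto simp: field_simps)
qed

theorem theorem11:
  fixes V :: "'v set" and E :: "'e set" and ends :: "'e \<Rightarrow> 'v set" and s t :: 'v
  assumes "multigraph V E ends"
    and "connected_by V ends E"
    and "s \<in> V" and "t \<in> V"
    and "\<And>U. U \<noteq> {} \<Longrightarrow> U \<subset> V \<Longrightarrow> card (U \<inter> {s, t}) \<noteq> 1 \<Longrightarrow> 3 \<le> card (edge_cut E ends U)"
  shows "convex_combination_of E (\<lambda>e. 1) (incidence_vector ` {M. st_tour V E ends s t M})"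
proof -
  interpret multigraph V E ends by (rule assms(1))
  obtain D where D: "D \<subseteq> E" "odd_set D = sym_diff {s} {t}"
    and cuts: "\<forall>U. U \<noteq> {} \<longrightarrow> U \<subset> V \<longrightarrow> edge_cut E ends U \<inter> D = {} \<longrightarrow> 4 \<le> card (edge_cut E ends U)"
    using assms(2-5) by (rule even_set_avoiding_small_cuts)
  obtain F1 F2 where F: "F1 \<subseteq> E - D" "F2 \<subseteq> E - D" "F1 \<inter> F2 = {}"
    and conn: "connected_by V ends (D \<union> F1)" "connected_by V ends (D \<union> F2)"
    using D(1) cuts[rule_format] by (rule two_disjoint_connecting_sets)
  \<comment> \<open>All remaining edges are taken in place of \<open>F2\<close>, so that
    \<open>F1\<close> and \<open>F\<close> partition \<open>E - D\<close>; enlarging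
    \<open>F2\<close> keeps connectivity.\<close>
  define F where "F = E - D - F1"
  have sub: "F1 \<subseteq> E" "F \<subseteq> E" "F2 \<subseteq> F" using F unfolding F_def by auto
  have "(adj ends (D \<union> F2))\<^sup>* \<subseteq> (adj ends (D \<union> F))\<^sup>*"
    using sub(3) by (intro adj_rtrancl_mono) auto
  then have conn': "connected_by V ends (D \<union> F)"
    using conn(2) unfolding connected_by_def by blast
  show ?thesis
  proof (rule convex_combination_of_midpoint)
    show "incidence_vector (mset_set D + (mset_set F1 + mset_set F1))
        \<in> incidence_vector ` {M. st_tour V E ends s t M}"
      using st_tour_double[OF D sub(1) conn(1)] by blast
    show "incidence_vector (mset_set D + (mset_set F + mset_set F))
        \<in> incidence_vector ` {M. st_tour V E ends s t M}"
      using st_tour_double[OF D sub(2) conn'] by blast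
    \<comment> \<open>An edge of \<open>D\<close> occurs once in both tours, any other edge twice in
      exactly one of them.\<close>
    fix e assume "e \<in> E"
    then show "1 = (incidence_vector (mset_set D + (mset_set F1 + mset_set F1)) e
        + incidence_vector (mset_set D + (mset_set F + mset_set F)) e) / 2"
      unfolding incidence_vector_double[OF D(1) sub(1)] incidence_vector_double[OF D(1) sub(2)]
      using F(1) unfolding F_def by auto
  qed
qed

end
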